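(* Let $\Bbbk$ be a field and $I \subseteq S=\Bbbk[x,y,z]$ a cofinite monomial ideal. If $I$ admits a singularizing triple, then $T_{\mathrm{nnp}}(I)$, $T_{\mathrm{npn}}(I)$ and $T_{\mathrm{pnn}}(I)$ are all non-zero, so $\dim_\Bbbk T(I)\geq 3\dim_\Bbbk(S/I)+6$.
   Context: Cofinite means $\dim_\Bbbk S/I<\infty$. $T(I)=\mathrm{Hom}_S(I,S/I)$ (the tangent space to the Hilbert scheme of points of $\mathbb{A}^3$ at $[S/I]$), which is $\mathbb Z^3$-graded since $I$ is monomial; $T(I)_{\mathbf a}$ denotes the component of degree $\mathbf a\in\mathbb Z^3$. For a signature $\mathfrak s\in\{\mathrm{p},\mathrm{n}\}^3$ put $\mathbb Z^3_{\mathfrak s}=\{\mathbf a\in\mathbb Z^3:\mathbf a_i\ge0\text{ if }\mathfrak s_i=\mathrm p,\ \mathbf a_i<0\text{ if }\mathfrak s_i=\mathrm n\}$ and $T_{\mathfrak s}(I)=\bigoplus_{\mathbf a\in\mathbb Z^3_{\mathfrak s}}T(I)_{\mathbf a}$. Monomials are identified with exponent vectors $\mathbf a=(\mathbf a_1,\mathbf a_2,\mathbf a_3)\in\mathbb N^3$. The monomials in $\mathrm{soc}(S/I)$ are the maximal elements, for divisibility, of the set of monomials not in $I$. A singularizing triple for $I$ is a triple of monomials $\{\mathbf a,\mathbf b,\mathbf c\}\subseteq\mathrm{soc}(S/I)$ such that $\mathbf a_1>\mathbf b_1,\mathbf c_1$; $\mathbf b_2>\mathbf a_2,\mathbf c_2$;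 $\mathbf c_3>\mathbf a_3,\mathbf b_3$. *)

theory Defs
  imports
    "HOL-Analysis.Finite_Cartesian_Product"
    "HOL-Library.Poly_Mapping"
    "HOL-Algebra.QuotRing"
    "HOL-Algebra.Algebraic_Closure_Type"
    "Jordan_Normal_Form.Missing_VectorSpace"
begin

no_notation fps_nth (infixl \<open>$\<close> 75)

section \<open>Modules and spaces of homomorphisms\<close>

text \<open>
  The record type of modules extends that of rings, so every module carries irrelevant
  \<open>mult\<close> and \<open>one\<close> fields.
\<close>

definition ideal_module :: "('a, 'm) ring_scheme \<Rightarrow> 'a set \<Rightarrow> ('a, 'a) module" where
  "ideal_module R I =
    \<lparr>carrier = I, monoid.mult = monoid.mult R, one = one R, zero = zero R, add = add R,
     module.smult = monoid.mult R\<rparr>"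

definition quotient_module :: "('a, 'm) ring_scheme \<Rightarrow> 'a set \<Rightarrow> ('a, 'a set) module" where
  "quotient_module R I =
    \<lparr>carrier = carrier (R Quot I), monoid.mult = monoid.mult (R Quot I),
     one = one (R Quot I), zero = zero (R Quot I), add = add (R Quot I),
     module.smult = (\<lambda>r c. (I +>\<^bsub>R\<^esub> r) \<otimes>\<^bsub>R Quot I\<^esub> c)\<rparr>"

text \<open>
  Homomorphisms are functions on the carrier of \<open>M\<close>; they are made \<open>extensional\<close> so that
  equality of HOL functions is equality of homomorphisms.
\<close>

definition Hom_module ::
  "('r, 'm) ring_scheme \<Rightarrow> ('r, 'a) module \<Rightarrow> ('r, 'b) module \<Rightarrow> ('r, 'a \<Rightarrow> 'b) module" where
  "Hom_module R M N =
    \<lparr>carrier = module_hom R M N \<inter> extensional (carrier M),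
     monoid.mult = (\<lambda>f g. \<lambda>x\<in>carrier M. \<zero>\<^bsub>N\<^esub>),
     one = (\<lambda>x\<in>carrier M. \<zero>\<^bsub>N\<^esub>),
     zero = (\<lambda>x\<in>carrier M. \<zero>\<^bsub>N\<^esub>),
     add = (\<lambda>f g. \<lambda>x\<in>carrier M. f x \<oplus>\<^bsub>N\<^esub> g x),
     module.smult = (\<lambda>r f. \<lambda>x\<in>carrier M. r \<odot>\<^bsub>N\<^esub> f x)\<rparr>"

definition restrict_scalars :: "('s \<Rightarrow> 'r) \<Rightarrow> ('r, 'a) module \<Rightarrow> ('s, 'a) module" where
  "restrict_scalars h M =
    \<lparr>carrier = carrier M, monoid.mult = monoid.mult M, one = one M, zero = zero M, add = add M,
     module.smult = (\<lambda>c. module.smult M (h c))\<rparr>"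

lemma module_ideal_module:
  assumes "cring R" "ideal I R"
  shows "Module.module R (ideal_module R I)"
proof -
  interpret cring R by fact
  interpret I: ideal I R by fact
  note [simp] = I.Icarr I.I_l_closed I.I_r_closed I.a_closed
  show ?thesis
  proof (rule moduleI)
    show "abelian_group (ideal_module R I)"
    proof (rule abelian_groupI)
      fix x assume x: "x \<in> carrier (ideal_module R I)"
      show "\<exists>y\<in>carrier (ideal_module R I).
              y \<oplus>\<^bsub>ideal_module R I\<^esub> x = \<zero>\<^bsub>ideal_module R I\<^esub>"
        using x I.a_inv_closed[of x]
        by (intro bexI[of _ "\<ominus>\<^bsub>R\<^esub> x"]) (auto simp: ideal_module_def l_neg)
    qed (auto simp: ideal_module_def a_ac I.zero_closed)
  qed (auto simp: ideal_module_def l_distr r_distr m_assoc cring_axioms)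
qed

lemma module_quotient_module:
  assumes "cring R" "ideal I R"
  shows "Module.module R (quotient_module R I)"
proof -
  interpret Q: cring "R Quot I"
    using ideal.quotient_is_cring[OF assms(2,1)] .
  interpret h: ring_hom_ring R "R Quot I" "(+>\<^bsub>R\<^esub>) I"
    using ideal.rcos_ring_hom_ring[OF assms(2)] .
  let ?M = "quotient_module R I"
  have sel: "carrier ?M = carrier (R Quot I)" "add ?M = add (R Quot I)"
    "zero ?M = zero (R Quot I)" "r \<odot>\<^bsub>?M\<^esub> c = (I +>\<^bsub>R\<^esub> r) \<otimes>\<^bsub>R Quot I\<^esub> c" for r c
    by (simp_all add: quotient_module_def)
  show ?thesis
  proof (rule moduleI)
    show "abelian_group ?M"
    proof (rule abelian_groupI)
      fix x assume "x \<in> carrier ?M"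
      then show "\<exists>y\<in>carrier ?M. y \<oplus>\<^bsub>?M\<^esub> x = \<zero>\<^bsub>?M\<^esub>"
        unfolding sel using Q.a_inv_closed Q.l_neg by blast
    qed (unfold sel, (rule Q.a_closed Q.zero_closed Q.a_assoc Q.a_comm Q.l_zero; assumption)+)
  qed (unfold sel, simp_all only: assms h.hom_closed h.hom_add h.hom_mult h.hom_one
         Q.m_closed Q.l_distr Q.r_distr Q.m_assoc Q.l_one Q.a_closed)
qed

lemma module_Hom_module:
  assumes "Module.module R M" "Module.module R N"
  shows "Module.module R (Hom_module R M N)"
proof -
  interpret M: Module.module R M by fact
  interpret N: Module.module R N by fact
  let ?H = "Hom_module R M N"
  have carr: "carrier ?H = module_hom R M N \<inter> extensional (carrier M)"
    by (simp add: Hom_module_def)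
  have closed: "f x \<in> carrier N" if "f \<in> carrier ?H" "x \<in> carrier M" for f x
    using that by (auto simp: carr module_hom_def)
  have apply_simps:
    "(f \<oplus>\<^bsub>?H\<^esub> g) x = f x \<oplus>\<^bsub>N\<^esub> g x"
    "(r \<odot>\<^bsub>?H\<^esub> f) x = r \<odot>\<^bsub>N\<^esub> f x"
    "\<zero>\<^bsub>?H\<^esub> x = \<zero>\<^bsub>N\<^esub>" if "x \<in> carrier M" for f g r x
    using that by (simp_all add: Hom_module_def)
  have ext: "f \<oplus>\<^bsub>?H\<^esub> g \<in> extensional (carrier M)"
    "r \<odot>\<^bsub>?H\<^esub> f \<in> extensional (carrier M)" "\<zero>\<^bsub>?H\<^esub> \<in> extensional (carrier M)" for f g r
    by (simp_all add: Hom_module_def)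
  have extf: "f \<in> extensional (carrier M)" if "f \<in> carrier ?H" for f
    using that by (simp add: carr)
  have eqI: "f = g" if "f \<in> extensional (carrier M)" "g \<in> extensional (carrier M)"
      "\<And>x. x \<in> carrier M \<Longrightarrow> f x = g x" for f g :: "'c \<Rightarrow> 'd"
    using that by (rule extensionalityI)
  have homI: "f \<in> carrier ?H" if "f \<in> extensional (carrier M)"
      "\<And>x. x \<in> carrier M \<Longrightarrow> f x \<in> carrier N"
      "\<And>x y. x \<in> carrier M \<Longrightarrow> y \<in> carrier M \<Longrightarrow> f (x \<oplus>\<^bsub>M\<^esub> y) = f x \<oplus>\<^bsub>N\<^esub> f y"
      "\<And>r x. r \<in> carrier R \<Longrightarrow> x \<in> carrier M \<Longrightarrow> f (r \<odot>\<^bsub>M\<^esub> x) = r \<odot>\<^bsub>N\<^esub> f x" for f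
    using that by (auto simp: carr module_hom_def)
  have hom: "f (x \<oplus>\<^bsub>M\<^esub> y) = f x \<oplus>\<^bsub>N\<^esub> f y" "f (r \<odot>\<^bsub>M\<^esub> x) = r \<odot>\<^bsub>N\<^esub> f x"
    if "f \<in> carrier ?H" "x \<in> carrier M" "y \<in> carrier M" "r \<in> carrier R" for f x y r
    using that by (auto simp: carr module_hom_def)
  have hom_add: "f (x \<oplus>\<^bsub>M\<^esub> y) = f x \<oplus>\<^bsub>N\<^esub> f y"
    if "f \<in> carrier ?H" "x \<in> carrier M" "y \<in> carrier M" for f x y
    using hom(1)[OF that M.R.zero_closed] .
  have hom_smult: "f (r \<odot>\<^bsub>M\<^esub> x) = r \<odot>\<^bsub>N\<^esub> f x"
    if "f \<in> carrier ?H" "x \<in> carrier M" "r \<in> carrier R" for f x r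
    using hom(2)[OF that(1,2,2,3)] .
  have comm: "r \<odot>\<^bsub>N\<^esub> (s \<odot>\<^bsub>N\<^esub> y) = s \<odot>\<^bsub>N\<^esub> (r \<odot>\<^bsub>N\<^esub> y)"
    if "r \<in> carrier R" "s \<in> carrier R" "y \<in> carrier N" for r s y
    using that by (metis N.smult_assoc1 M.R.m_comm)
  have zero_in: "\<zero>\<^bsub>?H\<^esub> \<in> carrier ?H"
    by (rule homI) (simp_all add: ext apply_simps)
  have add_in: "f \<oplus>\<^bsub>?H\<^esub> g \<in> carrier ?H" if "f \<in> carrier ?H" "g \<in> carrier ?H" for f g
    by (rule homI)
      (simp_all add: ext apply_simps that[THEN closed] that[THEN hom_add] that[THEN hom_smult]
        N.smult_r_distr N.M.a_ac)
  have smult_in: "r \<odot>\<^bsub>?H\<^esub> f \<in> carrier ?H" if "f \<in> carrier ?H" "r \<in> carrier R" for f r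
    by (rule homI)
      (simp_all add: ext apply_simps closed[OF that(1)] hom_add[OF that(1)] hom_smult[OF that(1)]
        that(2) N.smult_r_distr comm)
  show ?thesis
  proof (rule moduleI)
    show "abelian_group ?H"
    proof (rule abelian_groupI)
      fix f assume f: "f \<in> carrier ?H"
      have "(\<ominus>\<^bsub>R\<^esub> \<one>\<^bsub>R\<^esub>) \<odot>\<^bsub>?H\<^esub> f \<oplus>\<^bsub>?H\<^esub> f = \<zero>\<^bsub>?H\<^esub>"
        by (rule eqI) (simp_all add: ext apply_simps N.smult_minus_1 closed[OF f] N.M.l_neg)
      then show "\<exists>g\<in>carrier ?H. g \<oplus>\<^bsub>?H\<^esub> f = \<zero>\<^bsub>?H\<^esub>"
        using smult_in[OF f] by blast
    next
      fix f g h assume *: "f \<in> carrier ?H" "g \<in> carrier ?H" "h \<in> carrier ?H"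
      show "f \<oplus>\<^bsub>?H\<^esub> g \<oplus>\<^bsub>?H\<^esub> h = f \<oplus>\<^bsub>?H\<^esub> (g \<oplus>\<^bsub>?H\<^esub> h)"
        by (rule eqI) (simp_all add: ext apply_simps *[THEN closed] N.M.a_assoc)
    next
      fix f g assume *: "f \<in> carrier ?H" "g \<in> carrier ?H"
      show "f \<oplus>\<^bsub>?H\<^esub> g = g \<oplus>\<^bsub>?H\<^esub> f"
        by (rule eqI) (simp_all add: ext apply_simps *[THEN closed] N.M.a_comm)
    next
      fix f assume *: "f \<in> carrier ?H"
      show "\<zero>\<^bsub>?H\<^esub> \<oplus>\<^bsub>?H\<^esub> f = f"
        by (rule eqI) (simp_all add: ext extf[OF *] apply_simps closed[OF *])
    qed (use zero_in add_in in blast)+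
  next
    fix r s f assume *: "r \<in> carrier R" "s \<in> carrier R" "f \<in> carrier ?H"
    show "(r \<oplus>\<^bsub>R\<^esub> s) \<odot>\<^bsub>?H\<^esub> f = r \<odot>\<^bsub>?H\<^esub> f \<oplus>\<^bsub>?H\<^esub> s \<odot>\<^bsub>?H\<^esub> f"
      by (rule eqI) (simp_all add: ext apply_simps closed[OF *(3)] *(1,2) N.smult_l_distr)
    show "(r \<otimes>\<^bsub>R\<^esub> s) \<odot>\<^bsub>?H\<^esub> f = r \<odot>\<^bsub>?H\<^esub> (s \<odot>\<^bsub>?H\<^esub> f)"
      by (rule eqI) (simp_all add: ext apply_simps closed[OF *(3)] *(1,2) N.smult_assoc1)
  next
    fix r f g assume *: "r \<in> carrier R" "f \<in> carrier ?H" "g \<in> carrier ?H"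
    show "r \<odot>\<^bsub>?H\<^esub> (f \<oplus>\<^bsub>?H\<^esub> g) = r \<odot>\<^bsub>?H\<^esub> f \<oplus>\<^bsub>?H\<^esub> r \<odot>\<^bsub>?H\<^esub> g"
      by (rule eqI) (simp_all add: ext apply_simps closed[OF *(2)] closed[OF *(3)] *(1) N.smult_r_distr)
  next
    fix f assume *: "f \<in> carrier ?H"
    show "\<one>\<^bsub>R\<^esub> \<odot>\<^bsub>?H\<^esub> f = f"
      by (rule eqI) (simp_all add: ext extf[OF *] apply_simps closed[OF *])
  qed (use smult_in M.R.cring_axioms in auto)
qed

lemma vectorspace_restrict_scalars:
  assumes "field K" "Module.module R M" "h \<in> ring_hom K R"
  shows "vectorspace K (restrict_scalars h M)"
proof -
  interpret K: field K by fact
  interpret M: Module.module R M by fact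
  note [simp] = ring_hom_memE[OF assms(3)]
  have "Module.module K (restrict_scalars h M)"
  proof (rule moduleI)
    show "abelian_group (restrict_scalars h M)"
    proof (rule abelian_groupI)
      fix x assume "x \<in> carrier (restrict_scalars h M)"
      then show "\<exists>y\<in>carrier (restrict_scalars h M).
              y \<oplus>\<^bsub>restrict_scalars h M\<^esub> x = \<zero>\<^bsub>restrict_scalars h M\<^esub>"
        by (intro bexI[of _ "\<ominus>\<^bsub>M\<^esub> x"]) (auto simp: restrict_scalars_def M.l_neg)
    qed (auto simp: restrict_scalars_def M.M.a_ac)
  qed (auto simp: restrict_scalars_def M.smult_l_distr M.smult_r_distr M.smult_assoc1
         K.cring_axioms)
  then show ?thesis
    by (simp add: vectorspace_def K.field_axioms)
qed


section \<open>The polynomial ring in three variables\<close>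

text \<open>
  A polynomial is its finitely supported family of coefficients, indexed by exponent vectors
  in \<open>nat ^ 3\<close>; multiplication is convolution.  The order on
  \<open>nat ^ 3\<close> is the componentwise one, that is, divisibility of monomials.
\<close>

type_synonym 'k poly3 = "(nat ^ 3) \<Rightarrow>\<^sub>0 'k"

abbreviation base_field :: "'k::field ring" where
  "base_field \<equiv> ring_of_type_algebra"

abbreviation poly3_ring :: "'k::field poly3 ring" where
  "poly3_ring \<equiv> ring_of_type_algebra"

definition const_poly :: "'k::field \<Rightarrow> 'k poly3" where
  "const_poly c = Poly_Mapping.single 0 c"

definition monom3 :: "nat ^ 3 \<Rightarrow> 'k::field poly3" where
  "monom3 a = Poly_Mapping.single a 1"

definition monomial_ideal :: "'k::field poly3 set \<Rightarrow> bool" where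
  "monomial_ideal I \<longleftrightarrow> (\<exists>A. I = genideal poly3_ring (monom3 ` A))"

definition quotient_space :: "'k::field poly3 set \<Rightarrow> ('k, 'k poly3 set) module" where
  "quotient_space I = restrict_scalars const_poly (quotient_module poly3_ring I)"

definition cofinite_ideal :: "'k::field poly3 set \<Rightarrow> bool" where
  "cofinite_ideal I \<longleftrightarrow> vectorspace.fin_dim base_field (quotient_space I)"

definition tangent_space ::
  "'k::field poly3 set \<Rightarrow> ('k, 'k poly3 \<Rightarrow> 'k poly3 set) module" where
  "tangent_space I =
    restrict_scalars const_poly
      (Hom_module poly3_ring (ideal_module poly3_ring I) (quotient_module poly3_ring I))"

lemma const_poly_ring_hom: "const_poly \<in> ring_hom base_field poly3_ring"
  by (auto simp: ring_hom_def ring_of_type_algebra_def const_poly_def single_add mult_single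
      simp flip: single_one)

lemma vectorspace_quotient_space:
  assumes "ideal I (poly3_ring :: 'k::field poly3 ring)"
  shows "vectorspace base_field (quotient_space I)"
  unfolding quotient_space_def
  using assms
  by (intro vectorspace_restrict_scalars[where R = poly3_ring] field_from_type_algebra
      module_quotient_module cring_from_type_algebra const_poly_ring_hom)

lemma vectorspace_tangent_space:
  assumes "ideal I (poly3_ring :: 'k::field poly3 ring)"
  shows "vectorspace base_field (tangent_space I)"
  unfolding tangent_space_def
  using assms
  by (intro vectorspace_restrict_scalars[where R = poly3_ring] field_from_type_algebra
      module_Hom_module module_ideal_module module_quotient_module cring_from_type_algebra
      const_poly_ring_hom)


section \<open>The grading of the tangent space\<close>

text \<open>
  The homogeneous polynomials of degree \<open>c \<in> \<int>\<^sup>3\<close>; this is \<open>{0}\<close> unless all \<open>c $ i \<ge> 0\<close>.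
\<close>

definition poly_degree_part :: "int ^ 3 \<Rightarrow> 'k::field poly3 set" where
  "poly_degree_part c = {f. \<forall>b\<in>Poly_Mapping.keys f. (\<chi> i. int (b $ i)) = c}"

definition quotient_degree_part :: "'k::field poly3 set \<Rightarrow> int ^ 3 \<Rightarrow> 'k poly3 set set" where
  "quotient_degree_part I c = (\<lambda>f. I +>\<^bsub>poly3_ring\<^esub> f) ` poly_degree_part c"

definition tangent_degree_part ::
  "'k::field poly3 set \<Rightarrow> int ^ 3 \<Rightarrow> ('k poly3 \<Rightarrow> 'k poly3 set) set" where
  "tangent_degree_part I a =
    {\<phi> \<in> carrier (tangent_space I).
      \<forall>c. \<phi> ` (I \<inter> poly_degree_part c) \<subseteq> quotient_degree_part I (c + a)}"

datatype sign = sign_p | sign_n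

fun has_sign :: "int \<Rightarrow> sign \<Rightarrow> bool" where
  "has_sign m sign_p \<longleftrightarrow> m \<ge> 0"
| "has_sign m sign_n \<longleftrightarrow> m < 0"

fun orthant :: "sign \<times> sign \<times> sign \<Rightarrow> (int ^ 3) set" where
  "orthant (s1, s2, s3) = {a. has_sign (a $ 1) s1 \<and> has_sign (a $ 2) s2 \<and> has_sign (a $ 3) s3}"

text \<open>
  For a monomial ideal the graded components are independent, so this span is their internal
  direct sum.
\<close>

definition tangent_signature_part ::
  "'k::field poly3 set \<Rightarrow> sign \<times> sign \<times> sign \<Rightarrow> ('k poly3 \<Rightarrow> 'k poly3 set) set" where
  "tangent_signature_part I s =
    LinearCombinations.module.span base_field (tangent_space I)
      (\<Union>a\<in>orthant s. tangent_degree_part I a)"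


section \<open>Singularizing triples\<close>

definition socle_monomials :: "'k::field poly3 set \<Rightarrow> (nat ^ 3) set" where
  "socle_monomials I =
    {a. monom3 a \<notin> I \<and> (\<forall>b. monom3 b \<notin> I \<and> a \<le> b \<longrightarrow> b = a)}"

definition singularizing_triple ::
  "'k::field poly3 set \<Rightarrow> nat ^ 3 \<Rightarrow> nat ^ 3 \<Rightarrow> nat ^ 3 \<Rightarrow> bool" where
  "singularizing_triple I a b c \<longleftrightarrow>
    {a, b, c} \<subseteq> socle_monomials I \<and>
    a $ 1 > b $ 1 \<and> a $ 1 > c $ 1 \<and>
    b $ 2 > a $ 2 \<and> b $ 2 > c $ 2 \<and>
    c $ 3 > a $ 3 \<and> c $ 3 > b $ 3"

end

theory Submission
  imports Defs
begin

text \<open>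
  Let \<open>N\<close> be the finite set of monomials outside \<open>I\<close>. A tangent vector of degree \<open>a\<close> is a function on
  the monomials \<open>w \<in> I\<close> with \<open>w + a \<in> N\<close> that is constant along divisibility.

  For \<open>a\<close> of signature ppn such functions are the solutions of a linear system. Its number of unknowns
  minus its number of equations telescopes, when summed over all such \<open>a\<close>, to \<open>card N\<close>. A nonzero
  tangent vector in the dual degree \<open>- a - (1, 1, 1)\<close>, which has signature nnp, is a linear relation
  between the equations, hence produces one more solution. So a nonzero \<open>T\<^sub>n\<^sub>n\<^sub>p\<close> gives
  \<open>dim T\<^sub>p\<^sub>p\<^sub>n + dim T\<^sub>n\<^sub>n\<^sub>p \<ge> card N + 2\<close>; the two cyclic rotations of the coordinates give the other
  two summands of \<open>3 * card N + 6\<close>.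

  A singularizing triple yields a nonzero \<open>T\<^sub>n\<^sub>n\<^sub>p\<close>: move socle monomials that are high in the third
  direction by \<open>(i, j, -t)\<close> into \<open>I\<close>, below the first coordinate of \<open>a\<close>, the second of \<open>b\<close> and the
  third of both. If \<open>i + j - t\<close> is minimal, then the indicator function of the monomials of \<open>I\<close>
  dividing one of the results is a tangent vector.
\<close>

section \<open>Homogeneous linear systems\<close>

text \<open>Because \<open>a1 \<ge> 0\<close>, the monomials of \<open>I\<close> in one column along
  x whose targets lie in \<open>N\<close> form an interval, so a tangent vector of signature ppn is
  a function of columns \<open>(y, z)\<close> and the problem becomes planar. With differences of
  neighbouring columns as unknowns, all counts come from one kind of set,
  \<open>slab a1 e1 e2\<close>, taken at the four corners \<open>e1 \<in> {a2, a2 + 1}\<close>,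
  \<open>e2 \<in> {a3, a3 + 1}\<close> with alternating signs. Hence the sum over
  \<open>a2 \<ge> 0\<close>, \<open>a3 < 0\<close> telescopes to \<open>e1 = e2 = 0\<close>, where
  the slab consists of the columns higher than \<open>a1\<close>. The dual degree is visible in the
  same sets: a unit square at \<open>(y, z)\<close> yields an equation exactly if the lowest point
  of \<open>I\<close> over \<open>(y, z)\<close>, moved by \<open>- a - (1, 1, 1)\<close>, lies in
  \<open>N\<close>. A tangent vector of that degree therefore puts a weight on each square equation,
  and its constancy along divisibility makes the weighted sum cancel at every unknown. Of the
  surplus 2, one unit is the vector of signature nnp itself, the other is the solution gained from
  the redundant equation.\<close>

definition independent_solutions ::
  "('q \<Rightarrow> 'u \<Rightarrow> 'k::field) \<Rightarrow> 'u set \<Rightarrow> 'q set \<Rightarrow> 'u set \<Rightarrow> ('u \<Rightarrow> 'u \<Rightarrow> 'k) \<Rightarrow> bool" where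
  "independent_solutions A U Q J s \<longleftrightarrow>
    (\<forall>j\<in>J. (\<forall>u. u \<notin> U \<longrightarrow> s j u = 0) \<and> (\<forall>q\<in>Q. (\<Sum>u\<in>U. A q u * s j u) = 0)) \<and>
    (\<forall>c. (\<forall>u\<in>U. (\<Sum>j\<in>J. c j * s j u) = 0) \<longrightarrow> (\<forall>j\<in>J. c j = 0))"

text \<open>Each further equation costs at most one solution: if some \<open>s i\<close> violates
  it, subtracting multiples of \<open>s i\<close> repairs the others, and only \<open>s i\<close> is
  dropped.\<close>

lemma homogeneous_system_solutions:
  fixes A :: "'q \<Rightarrow> 'u \<Rightarrow> 'k::field"
  assumes U: "finite U" and Q: "finite Q"
  shows "\<exists>J s. J \<subseteq> U \<and> card U \<le> card J + card Q \<and> independent_solutions A U Q J s"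
  using Q
proof induction
  case empty
  show ?case
    unfolding independent_solutions_def
  proof (intro exI[of _ U] exI[of _ "\<lambda>j u. if u = j then 1 else 0"] conjI allI impI ballI)
    fix c :: "'u \<Rightarrow> 'k" and j assume *: "\<forall>u\<in>U. (\<Sum>k\<in>U. c k * (if u = k then 1 else 0)) = 0" and "j \<in> U"
    then have "(\<Sum>k\<in>U. c k * (if j = k then 1 else 0)) = 0" by blast
    also have "(\<Sum>k\<in>U. c k * (if j = k then 1 else 0)) = (\<Sum>k\<in>U. if j = k then c k else 0)"
      by (rule sum.cong) auto
    finally show "c j = 0" using U \<open>j \<in> U\<close> by simp
  qed auto
next
  case (insert q Q)
  from insert.IH obtain J s where J: "J \<subseteq> U" "card U \<le> card J + card Q"
    and sol: "independent_solutions A U Q J s"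
    by blast
  have s: "s j u = 0" if "j \<in> J" "u \<notin> U" for j u
    using sol that by (simp add: independent_solutions_def)
  have sQ: "(\<Sum>u\<in>U. A q u * s j u) = 0" if "j \<in> J" "q \<in> Q" for j q
    using sol that by (simp add: independent_solutions_def)
  have ind: "c j = 0" if "\<And>u. u \<in> U \<Longrightarrow> (\<Sum>j\<in>J. c j * s j u) = 0" "j \<in> J" for c j
    using sol that by (simp add: independent_solutions_def)
  have fJ: "finite J" using J U finite_subset by blast
  define e where "e j = (\<Sum>u\<in>U. A q u * s j u)" for j
  show ?case
  proof (cases "\<forall>j\<in>J. e j = 0")
    case True
    then have "independent_solutions A U (insert q Q) J s"
      using sol by (simp add: independent_solutions_def e_def)
    with insert.hyps J show ?thesis
      by (intro exI[of _ J] exI[of _ s]) auto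
  next
    case False
    then obtain i where i: "i \<in> J" "e i \<noteq> 0" by auto
    define r where "r j u = s j u - e j / e i * s i u" for j u
    show ?thesis
      unfolding independent_solutions_def
    proof (intro exI[of _ "J - {i}"] exI[of _ r] conjI ballI allI impI)
      show "J - {i} \<subseteq> U" "card U \<le> card (J - {i}) + card (insert q Q)"
        using J insert.hyps i fJ by (auto simp: card_Diff_singleton card_gt_0_iff)
    next
      fix j u assume "j \<in> J - {i}" "u \<notin> U"
      then show "r j u = 0" using s i by (simp add: r_def)
    next
      fix j q' assume j: "j \<in> J - {i}" and q': "q' \<in> insert q Q"
      have "(\<Sum>u\<in>U. A q' u * r j u) =
          (\<Sum>u\<in>U. A q' u * s j u) - e j / e i * (\<Sum>u\<in>U. A q' u * s i u)"
        by (simp add: r_def sum_distrib_left algebra_simps sum_subtractf)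
      also have "\<dots> = 0" using q' j i sQ by (auto simp flip: e_def)
      finally show "(\<Sum>u\<in>U. A q' u * r j u) = 0" .
    next
      fix c j assume c: "\<forall>u\<in>U. (\<Sum>j\<in>J - {i}. c j * r j u) = 0" and j: "j \<in> J - {i}"
      \<comment> \<open>A relation among the \<open>r j\<close> becomes one among the
        \<open>s j\<close> when the subtracted multiples of \<open>s i\<close> are collected into a
        coefficient for \<open>i\<close>.\<close>
      define d where "d k = (if k = i then - (\<Sum>j\<in>J - {i}. c j * (e j / e i)) else c k)" for k
      have "(\<Sum>k\<in>J. d k * s k u) = 0" if "u \<in> U" for u
      proof -
        have "(\<Sum>k\<in>J. d k * s k u) = d i * s i u + (\<Sum>k\<in>J - {i}. c k * s k u)"
          using i fJ by (simp add: sum.remove[of J i] d_def)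
        also have "\<dots> = (\<Sum>k\<in>J - {i}. c k * r k u)"
          by (simp add: d_def r_def sum_distrib_right sum_distrib_left algebra_simps sum_subtractf)
        finally show ?thesis using c that by simp
      qed
      from ind[OF this, of j] j show "c j = 0" by (auto simp: d_def)
    qed
  qed
qed

text \<open>The relation writes the equation \<open>q\<close> as a combination of the others, so
  solving the system without \<open>q\<close> saves one equation.\<close>

lemma homogeneous_system_solutions_relation:
  fixes A :: "'q \<Rightarrow> 'u \<Rightarrow> 'k::field"
  assumes U: "finite U" and Q: "finite Q" and q: "q \<in> Q" "\<psi> q \<noteq> 0"
    and rel: "\<And>u. u \<in> U \<Longrightarrow> (\<Sum>q\<in>Q. \<psi> q * A q u) = 0"
  shows "\<exists>J s. J \<subseteq> U \<and> card U + 1 \<le> card J + card Q \<and> independent_solutions A U Q J s"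
proof -
  obtain J s where J: "J \<subseteq> U" "card U \<le> card J + card (Q - {q})"
    and sol: "independent_solutions A U (Q - {q}) J s"
    using homogeneous_system_solutions[OF U, of "Q - {q}" A] Q by blast
  have s: "(\<Sum>u\<in>U. A q' u * s j u) = 0" if "j \<in> J" "q' \<in> Q - {q}" for j q'
    using sol that by (simp add: independent_solutions_def)
  have "(\<Sum>u\<in>U. A q u * s j u) = 0" if j: "j \<in> J" for j
  proof -
    have "\<psi> q * (\<Sum>u\<in>U. A q u * s j u) = (\<Sum>q\<in>Q. \<psi> q * (\<Sum>u\<in>U. A q u * s j u))"
      using q Q s[OF j] by (simp add: sum.remove[of Q q])
    also have "\<dots> = (\<Sum>q\<in>Q. \<Sum>u\<in>U. \<psi> q * A q u * s j u)"
      by (simp add: sum_distrib_left mult.assoc)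
    also have "\<dots> = (\<Sum>u\<in>U. (\<Sum>q\<in>Q. \<psi> q * A q u) * s j u)"
      by (subst sum.swap) (simp add: sum_distrib_right)
    finally show ?thesis using rel q by simp
  qed
  with s have "independent_solutions A U Q J s"
    using sol unfolding independent_solutions_def by blast
  moreover have "0 < card Q" using q Q by (auto simp: card_gt_0_iff)
  ultimately show ?thesis
    using J q Q by (intro exI[of _ J] exI[of _ s]) (simp add: card_Diff_singleton)
qed

section \<open>Homogeneous tangent vectors\<close>

text \<open>
  A homogeneous homomorphism \<open>I \<rightarrow> S/I\<close> of degree \<open>a\<close>, for the ideal \<open>I\<close> spanned by the monomials
  outside \<open>N\<close>, maps each monomial \<open>w\<close> of \<open>I\<close> to \<open>\<phi> w\<close> times the monomial \<open>w + a\<close>; the coefficient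
  \<open>\<phi> w\<close> is set to 0 when \<open>w + a\<close> is not in \<open>N\<close>.
\<close>

definition hom_coeffs ::
  "(int \<Rightarrow> int \<Rightarrow> int \<Rightarrow> bool) \<Rightarrow> int \<Rightarrow> int \<Rightarrow> int \<Rightarrow> (int \<Rightarrow> int \<Rightarrow> int \<Rightarrow> 'k::field) \<Rightarrow> bool" where
  "hom_coeffs N a1 a2 a3 \<phi> \<longleftrightarrow>
    (\<forall>x y z. \<phi> x y z \<noteq> 0 \<longrightarrow>
      0 \<le> x \<and> 0 \<le> y \<and> 0 \<le> z \<and> \<not> N x y z \<and> N (x + a1) (y + a2) (z + a3)) \<and>
    (\<forall>x y z x' y' z'. 0 \<le> x \<and> 0 \<le> y \<and> 0 \<le> z \<and> \<not> N x y z \<and>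
      x \<le> x' \<and> y \<le> y' \<and> z \<le> z' \<and> N (x' + a1) (y' + a2) (z' + a3) \<longrightarrow> \<phi> x y z = \<phi> x' y' z')"

lemma hom_coeffsI:
  assumes "\<And>x y z. \<phi> x y z \<noteq> 0 \<Longrightarrow>
      0 \<le> x \<and> 0 \<le> y \<and> 0 \<le> z \<and> \<not> N x y z \<and> N (x + a1) (y + a2) (z + a3)"
    and "\<And>x y z x' y' z'. 0 \<le> x \<Longrightarrow> 0 \<le> y \<Longrightarrow> 0 \<le> z \<Longrightarrow> \<not> N x y z \<Longrightarrow>
      x \<le> x' \<Longrightarrow> y \<le> y' \<Longrightarrow> z \<le> z' \<Longrightarrow> N (x' + a1) (y' + a2) (z' + a3) \<Longrightarrow> \<phi> x y z = \<phi> x' y' z'"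
  shows "hom_coeffs N a1 a2 a3 \<phi>"
  using assms unfolding hom_coeffs_def by blast

lemma hom_coeffs_nonzeroD:
  assumes "hom_coeffs N a1 a2 a3 \<phi>" "\<phi> x y z \<noteq> 0"
  shows "0 \<le> x" "0 \<le> y" "0 \<le> z" "\<not> N x y z" "N (x + a1) (y + a2) (z + a3)"
  using assms unfolding hom_coeffs_def by blast+

lemma hom_coeffs_eqD:
  assumes "hom_coeffs N a1 a2 a3 \<phi>" "0 \<le> x" "0 \<le> y" "0 \<le> z" "\<not> N x y z"
    "x \<le> x'" "y \<le> y'" "z \<le> z'" "N (x' + a1) (y' + a2) (z' + a3)"
  shows "\<phi> x y z = \<phi> x' y' z'"
  using assms unfolding hom_coeffs_def by blast

definition indep_homs ::
  "(int \<Rightarrow> int \<Rightarrow> int \<Rightarrow> bool) \<Rightarrow> int \<Rightarrow> int \<Rightarrow> int \<Rightarrow> nat \<Rightarrow> (nat \<Rightarrow> int \<Rightarrow> int \<Rightarrow> int \<Rightarrow> 'k::field) \<Rightarrow> bool" where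
  "indep_homs N a1 a2 a3 n s \<longleftrightarrow> (\<forall>j<n. hom_coeffs N a1 a2 a3 (s j)) \<and>
    (\<forall>c. (\<forall>x y z. (\<Sum>j<n. c j * s j x y z) = 0) \<longrightarrow> (\<forall>j<n. c j = 0))"

definition socle_point :: "(int \<Rightarrow> int \<Rightarrow> int \<Rightarrow> bool) \<Rightarrow> int \<Rightarrow> int \<Rightarrow> int \<Rightarrow> bool" where
  "socle_point N x y z \<longleftrightarrow> N x y z \<and>
    (\<forall>x' y' z'. N x' y' z' \<and> x \<le> x' \<and> y \<le> y' \<and> z \<le> z' \<longrightarrow> x' = x \<and> y' = y \<and> z' = z)"

locale staircase =
  fixes N :: "int \<Rightarrow> int \<Rightarrow> int \<Rightarrow> bool" and M :: int
  assumes nonneg: "N x y z \<Longrightarrow> 0 \<le> x \<and> 0 \<le> y \<and> 0 \<le> z"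
    and down: "N x y z \<Longrightarrow> 0 \<le> x' \<Longrightarrow> 0 \<le> y' \<Longrightarrow> 0 \<le> z' \<Longrightarrow>
      x' \<le> x \<Longrightarrow> y' \<le> y \<Longrightarrow> z' \<le> z \<Longrightarrow> N x' y' z'"
    and bounded: "N x y z \<Longrightarrow> x < M \<and> y < M \<and> z < M"
begin

text \<open>Two comparable monomials are joined by a path of x-steps, then y-steps, then z-steps. It
  stays in the ideal, and by \<open>down\<close> its targets stay in \<open>N\<close> while they are
  nonnegative; at a step whose upper target has a negative coordinate, both ends have coefficient
  0.\<close>

lemma hom_coeffs_stepI:
  assumes supp: "\<And>x y z. \<phi> x y z \<noteq> 0 \<Longrightarrow>
      0 \<le> x \<and> 0 \<le> y \<and> 0 \<le> z \<and> \<not> N x y z \<and> N (x + a1) (y + a2) (z + a3)"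
    and x: "\<And>x y z. 0 \<le> x \<Longrightarrow> 0 \<le> y \<Longrightarrow> 0 \<le> z \<Longrightarrow> \<not> N x y z \<Longrightarrow>
      N (x + 1 + a1) (y + a2) (z + a3) \<Longrightarrow> \<phi> x y z = \<phi> (x + 1) y z"
    and y: "\<And>x y z. 0 \<le> x \<Longrightarrow> 0 \<le> y \<Longrightarrow> 0 \<le> z \<Longrightarrow> \<not> N x y z \<Longrightarrow>
      N (x + a1) (y + 1 + a2) (z + a3) \<Longrightarrow> \<phi> x y z = \<phi> x (y + 1) z"
    and z: "\<And>x y z. 0 \<le> x \<Longrightarrow> 0 \<le> y \<Longrightarrow> 0 \<le> z \<Longrightarrow> \<not> N x y z \<Longrightarrow>
      N (x + a1) (y + a2) (z + 1 + a3) \<Longrightarrow> \<phi> x y z = \<phi> x y (z + 1)"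
  shows "hom_coeffs N a1 a2 a3 \<phi>"
proof (rule hom_coeffsI)
  fix x y z :: int and x' y' z' :: int
  assume A: "0 \<le> x" "0 \<le> y" "0 \<le> z" "\<not> N x y z" "x \<le> x'" "y \<le> y'" "z \<le> z'"
    "N (x' + a1) (y' + a2) (z' + a3)"
  have neg: "\<phi> x y z = 0" if "x + a1 < 0 \<or> y + a2 < 0 \<or> z + a3 < 0" for x y z
    using supp nonneg that by (meson not_less)
  have up: "\<not> N u v w" if "x \<le> u" "y \<le> v" "z \<le> w" for u v w
    using down A that by blast
  have 1: "\<phi> x y z = \<phi> u y z" if "x \<le> u" "u \<le> x'" for u
    using that
  proof (induction u rule: int_ge_induct)
    case (step u)
    show ?case
    proof (cases "u + 1 + a1 < 0 \<or> y + a2 < 0 \<or> z + a3 < 0")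
      case True
      with neg[of u y z] neg[of "u + 1" y z] step show ?thesis by fastforce
    next
      case False
      then have "N (u + 1 + a1) (y + a2) (z + a3)" using A step by (intro down[OF A(8)]) auto
      with x[of u y z] step A up[of u y z] show ?thesis by simp
    qed
  qed simp
  have 2: "\<phi> x' y z = \<phi> x' u z" if "y \<le> u" "u \<le> y'" for u
    using that
  proof (induction u rule: int_ge_induct)
    case (step u)
    show ?case
    proof (cases "x' + a1 < 0 \<or> u + 1 + a2 < 0 \<or> z + a3 < 0")
      case True
      with neg[of x' u z] neg[of x' "u + 1" z] step show ?thesis by fastforce
    next
      case False
      then have "N (x' + a1) (u + 1 + a2) (z + a3)" using A step by (intro down[OF A(8)]) auto
      with y[of x' u z] step A up[of x' u z] show ?thesis by simp
    qed
  qed simp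
  have 3: "\<phi> x' y' z = \<phi> x' y' u" if "z \<le> u" "u \<le> z'" for u
    using that
  proof (induction u rule: int_ge_induct)
    case (step u)
    show ?case
    proof (cases "x' + a1 < 0 \<or> y' + a2 < 0 \<or> u + 1 + a3 < 0")
      case True
      with neg[of x' y' u] neg[of x' y' "u + 1"] step show ?thesis by fastforce
    next
      case False
      then have "N (x' + a1) (y' + a2) (u + 1 + a3)" using A step by (intro down[OF A(8)]) auto
      with z[of x' y' u] step A up[of x' y' u] show ?thesis by simp
    qed
  qed simp
  show "\<phi> x y z = \<phi> x' y' z'" using 1[of x'] 2[of y'] 3[of z'] A by simp
qed (use supp in blast)

section \<open>Tangent vectors of signature nnp from a singularizing triple\<close>

lemma ex_socle_point_above:
  assumes "N x y z"
  shows "\<exists>u v w. socle_point N u v w \<and> x \<le> u \<and> y \<le> v \<and> z \<le> w"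
  using assms
proof (induction "nat (3 * M - (x + y + z))" arbitrary: x y z rule: less_induct)
  case less
  show ?case
  proof (cases "socle_point N x y z")
    case False
    with less.prems obtain x' y' z' where *: "N x' y' z'" "x \<le> x'" "y \<le> y'" "z \<le> z'"
      "(x', y', z') \<noteq> (x, y, z)"
      unfolding socle_point_def by auto
    then have "nat (3 * M - (x' + y' + z')) < nat (3 * M - (x + y + z))"
      using bounded[OF *(1)] by auto
    from less.hyps[OF this *(1)] * show ?thesis by (meson order_trans)
  qed auto
qed

text \<open>Minimality of \<open>i + j - t\<close> makes the indicator function constant along
  divisibility. If a monomial of the support divides one whose target lies in \<open>N\<close>, a
  socle monomial \<open>f\<close> above that target can be moved by some
  \<open>(i', j', -t')\<close> with \<open>i' \<le> i\<close>, \<open>j' \<le> j\<close>,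
  \<open>t' \<ge> t\<close>; by minimality this is the original move, so the larger monomial is in
  the support too.\<close>

lemma ex_nonzero_nnp_hom:
  assumes a: "socle_point N a1 a2 a3" and b: "socle_point N b1 b2 b3" and c: "socle_point N c1 c2 c3"
    and triple: "b1 < a1" "c1 < a1" "a2 < b2" "c2 < b2" "a3 < c3" "b3 < c3"
  shows "\<exists>i j t \<phi>. 1 \<le> i \<and> 1 \<le> j \<and> 0 \<le> t \<and>
    hom_coeffs N (-i) (-j) t (\<phi> :: int \<Rightarrow> int \<Rightarrow> int \<Rightarrow> 'k::field) \<and> (\<exists>x y z. \<phi> x y z \<noteq> 0)"
proof -
  define low high where "low = min a3 b3" and "high = max a3 b3"
  define E where "E x y z \<longleftrightarrow> 0 \<le> x \<and> 0 \<le> y \<and> 0 \<le> z \<and> \<not> N x y z" for x y z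
  \<comment> \<open>The moved monomial has to stay below \<open>(a1, b2, low)\<close>, and
    \<open>high < d3\<close> places \<open>d\<close> above \<open>a\<close> and \<open>b\<close> in
    the third direction; both are needed to exploit the maximality of \<open>a\<close> and
    \<open>b\<close>.\<close>
  define active where "active i j t d1 d2 d3 \<longleftrightarrow> socle_point N d1 d2 d3 \<and> d1 + i \<le> a1 \<and>
      d2 + j \<le> b2 \<and> high < d3 \<and> d3 - t \<le> low \<and> E (d1 + i) (d2 + j) (d3 - t)" for i j t d1 d2 d3
  define P where "P = (\<lambda>(i, j, t). 1 \<le> i \<and> 1 \<le> j \<and> (\<exists>d1 d2 d3. active i j t d1 d2 d3))"
  have Na: "N a1 a2 a3" and Nb: "N b1 b2 b3" and Nc: "N c1 c2 c3"
    using a b c by (auto simp: socle_point_def)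
  have maxD: "x = d1 \<and> y = d2 \<and> z = d3"
    if "socle_point N d1 d2 d3" "N x y z" "d1 \<le> x" "d2 \<le> y" "d3 \<le> z" for x y z d1 d2 d3
    using that unfolding socle_point_def by blast
  have socN: "N d1 d2 d3" if "socle_point N d1 d2 d3" for d1 d2 d3
    using that by (simp add: socle_point_def)
  have Eup: "E x' y' z'" if "E x y z" "x \<le> x'" "y \<le> y'" "z \<le> z'" for x y z x' y' z'
    using that down unfolding E_def by (meson order_trans)
  have nn: "0 \<le> a1 \<and> 0 \<le> a2 \<and> 0 \<le> a3" "0 \<le> b1 \<and> 0 \<le> b2 \<and> 0 \<le> b3"
    using nonneg Na Nb by blast+
  \<comment> \<open>Since \<open>low\<close> is \<open>a3\<close> or \<open>b3\<close>, this point
    lies strictly above the socle point \<open>a\<close> or \<open>b\<close>. Hence moving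
    \<open>c\<close> exactly onto it is an admissible move.\<close>
  have "\<not> N a1 b2 low"
    using maxD[OF a, of a1 b2 low] maxD[OF b, of a1 b2 low] triple unfolding low_def
    by (metis min_def order_less_imp_le order_less_irrefl order_refl)
  then have "E a1 b2 low" using nn by (auto simp: E_def low_def)
  then have "active (a1 - c1) (b2 - c2) (c3 - low) c1 c2 c3"
    using c triple by (auto simp: active_def high_def)
  then have "P (a1 - c1, b2 - c2, c3 - low)"
    using triple by (auto simp: P_def)
  \<comment> \<open>Adding \<open>M\<close> makes the truncation by \<open>nat\<close> harmless: an
    active move has \<open>t < M\<close>, because \<open>d3 < M\<close> and
    \<open>d3 - t \<ge> 0\<close>.\<close>
  then obtain w where w: "P w"
    and wmin: "\<And>v. P v \<Longrightarrow> (\<lambda>(i, j, t). nat (i + j - t + M)) w \<le> (\<lambda>(i, j, t). nat (i + j - t + M)) v"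
    using ex_has_least_nat[of P _ "\<lambda>(i, j, t). nat (i + j - t + M)"] by blast
  obtain i j t where ijt: "w = (i, j, t)" by (cases w)
  have ij: "1 \<le> i" "1 \<le> j" using w by (auto simp: P_def ijt)
  have tM: "t' < M" if "active i' j' t' d1 d2 d3" for i' j' t' d1 d2 d3
    using that bounded[OF socN] unfolding active_def E_def by fastforce
  have least: "i + j - t \<le> i' + j' - t'"
    if "1 \<le> i'" "1 \<le> j'" "active i' j' t' d1 d2 d3" for i' j' t' d1 d2 d3
  proof -
    have "P (i', j', t')" using that by (auto simp: P_def)
    from wmin[OF this] tM[OF that(3)] that(1,2) show ?thesis by (auto simp: ijt)
  qed
  obtain d1 d2 d3 where d: "active i j t d1 d2 d3" using w by (auto simp: P_def ijt)
  have t: "1 \<le> t" using d unfolding active_def low_def high_def by auto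
  define \<phi> :: "int \<Rightarrow> int \<Rightarrow> int \<Rightarrow> 'k" where "\<phi> x y z =
    of_bool (E x y z \<and> i \<le> x \<and> j \<le> y \<and>
      (\<exists>d1 d2 d3. active i j t d1 d2 d3 \<and> x \<le> d1 + i \<and> y \<le> d2 + j \<and> z \<le> d3 - t))" for x y z
  \<comment> \<open>Any room left in one direction would permit a larger \<open>t\<close>, a smaller
    \<open>i\<close> or a smaller \<open>j\<close>, against minimality. The bounds by
    \<open>a2\<close> and \<open>b1\<close> hold because otherwise the point would lie below
    \<open>a\<close> or \<open>b\<close>, hence in \<open>N\<close>.\<close>
  have key: "z = e3 - t \<and> a2 < y \<and> b1 < x \<and> (i = 1 \<or> x = e1 + i) \<and> (j = 1 \<or> y = e2 + j)"
    if e: "active i j t e1 e2 e3" and E: "E x y z" "x \<le> e1 + i" "y \<le> e2 + j" "z \<le> e3 - t"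
    for x y z e1 e2 e3
  proof -
    have s: "socle_point N e1 e2 e3" "e1 + i \<le> a1" "e2 + j \<le> b2" "high < e3" "e3 - t \<le> low"
      using e by (auto simp: active_def)
    have not_smaller: "i' = i \<and> j' = j \<and> t' = t"
      if "1 \<le> i'" "i' \<le> i" "1 \<le> j'" "j' \<le> j" "t \<le> t'"
        "x \<le> e1 + i'" "y \<le> e2 + j'" "z \<le> e3 - t'" for i' j' t'
    proof -
      have "active i' j' t' e1 e2 e3"
        using s that Eup[OF E(1) that(6-8)] by (auto simp: active_def)
      from least[OF that(1,3) this] that show ?thesis by auto
    qed
    have 1: "z = e3 - t"
      using not_smaller[of i j "t + 1"] ij E by force
    have 2: "i = 1 \<or> x = e1 + i"
      using not_smaller[of "i - 1" j t] ij E by force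
    have 3: "j = 1 \<or> y = e2 + j"
      using not_smaller[of i "j - 1" t] ij E by force
    have 4: "a2 < y"
    proof (rule ccontr)
      assume "\<not> a2 < y"
      then have "N x y z" using E s Na by (intro down[OF Na]) (auto simp: E_def low_def)
      with E show False by (simp add: E_def)
    qed
    have 5: "b1 < x"
    proof (rule ccontr)
      assume "\<not> b1 < x"
      then have "N x y z" using E s Nb by (intro down[OF Nb]) (auto simp: E_def low_def)
      with E show False by (simp add: E_def)
    qed
    from 1 2 3 4 5 show ?thesis by blast
  qed
  have "hom_coeffs N (-i) (-j) t \<phi>"
  proof (rule hom_coeffsI)
    fix x y z assume "\<phi> x y z \<noteq> 0"
    then obtain d1 d2 d3 where *: "E x y z" "i \<le> x" "j \<le> y"
      "active i j t d1 d2 d3" "x \<le> d1 + i" "y \<le> d2 + j" "z \<le> d3 - t"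
      by (auto simp: \<phi>_def)
    have "N (x - i) (y - j) (z + t)"
      using * t by (intro down[OF socN[of d1 d2 d3]]) (auto simp: active_def E_def)
    with * show "0 \<le> x \<and> 0 \<le> y \<and> 0 \<le> z \<and> \<not> N x y z \<and> N (x + - i) (y + - j) (z + t)"
      by (auto simp: E_def)
  next
    fix x y z x' y' z'
    assume A: "0 \<le> x" "0 \<le> y" "0 \<le> z" "\<not> N x y z" "x \<le> x'" "y \<le> y'" "z \<le> z'"
      "N (x' + - i) (y' + - j) (z' + t)"
    have E: "E x y z" and E': "E x' y' z'" using A Eup[of x y z] by (auto simp: E_def)
    have nn': "i \<le> x'" "j \<le> y'" using nonneg[OF A(8)] by auto
    show "\<phi> x y z = \<phi> x' y' z'"
    proof (cases "\<exists>e1 e2 e3. active i j t e1 e2 e3 \<and> x \<le> e1 + i \<and> y \<le> e2 + j \<and> z \<le> e3 - t")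
      case False
      then have "\<phi> x y z = 0" "\<phi> x' y' z' = 0"
        using A(5-7) unfolding \<phi>_def by (auto, (meson order_trans)+)
      then show ?thesis by simp
    next
      case True
      then obtain e1 e2 e3 where e: "active i j t e1 e2 e3" "x \<le> e1 + i" "y \<le> e2 + j" "z \<le> e3 - t"
        by blast
      have es: "socle_point N e1 e2 e3" "e1 + i \<le> a1" "e2 + j \<le> b2" "high < e3" "e3 - t \<le> low"
        using e by (auto simp: active_def)
      have e0: "0 \<le> e1" "0 \<le> e2" using nonneg[OF socN[OF es(1)]] by auto
      note k = key[OF e(1) E e(2-4)]
      \<comment> \<open>If \<open>i = 1\<close>, this is \<open>0 \<le> b1 < x\<close>; otherwise
        \<open>x = e1 + i\<close>.\<close>
      have "i \<le> x" using k ij e0 nn triple by auto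
      have "j \<le> y" using k ij e0 nn triple by auto
      have one: "\<phi> x y z = 1"
        using E \<open>i \<le> x\<close> \<open>j \<le> y\<close> e by (auto simp: \<phi>_def)
      obtain f1 f2 f3 where f: "socle_point N f1 f2 f3" "x' - i \<le> f1" "y' - j \<le> f2" "z' + t \<le> f3"
        using ex_socle_point_above[OF A(8)] by auto
      note fN = socN[OF f(1)] and eN = socN[OF es(1)]
      have f3: "e3 \<le> f3" using k A f by auto
      \<comment> \<open>If \<open>f1 \<ge> a1\<close>, maximality of \<open>a\<close> gives
        \<open>f2 < a2 < y'\<close>, which excludes \<open>j = 1\<close> and so yields
        \<open>e2 \<le> f2\<close>. Then \<open>f\<close> lies above \<open>e\<close> with a larger
        first coordinate, against maximality of \<open>e\<close>.\<close>
      have f1: "f1 < a1"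
      proof (rule ccontr)
        assume n: "\<not> f1 < a1"
        have "\<not> a2 \<le> f2"
          using maxD[OF a fN] n f3 es(4) unfolding high_def by auto
        then have "j \<noteq> 1" using k A f by auto
        then have "e2 \<le> f2" using k A f by auto
        then have "f1 = e1"
          using maxD[OF es(1) fN] f3 n es(2) ij by auto
        then show False using n es ij by auto
      qed
      have f2: "f2 < b2"
      proof (rule ccontr)
        assume n: "\<not> f2 < b2"
        have "\<not> b1 \<le> f1"
          using maxD[OF b fN] n f3 es(4) unfolding high_def by auto
        then have "i \<noteq> 1" using k A f by auto
        then have "e1 \<le> f1" using k A f by auto
        then have "f2 = e2"
          using maxD[OF es(1) fN] f3 n es(3) ij by auto
        then show False using n es ij by auto
      qed
      \<comment> \<open>Capping by \<open>a1 - f1\<close> and \<open>b2 - f2\<close> keeps the moved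
        \<open>f\<close> below \<open>a1\<close> and \<open>b2\<close>, while it still lies above
        \<open>(x, y, z)\<close>.\<close>
      define i' j' t' where "i' = min i (a1 - f1)" and "j' = min j (b2 - f2)" and "t' = f3 - z"
      have "E (f1 + i') (f2 + j') (f3 - t')"
        by (rule Eup[OF E]) (use A f e es in \<open>auto simp: i'_def j'_def t'_def\<close>)
      then have "active i' j' t' f1 f2 f3"
        using f es f3 k by (auto simp: active_def i'_def j'_def t'_def)
      moreover from least[OF _ _ this] have "i' = i \<and> j' = j \<and> t' = t"
        using f1 f2 ij f3 k by (auto simp: i'_def j'_def t'_def)
      ultimately have "active i j t f1 f2 f3" by simp
      then have "\<phi> x' y' z' = 1"
        using E' nn' f unfolding \<phi>_def by force
      with one show ?thesis by simp
    qed
  qed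
  moreover have "\<phi> (d1 + i) (d2 + j) (d3 - t) \<noteq> 0"
    using d nonneg[OF socN, of d1 d2 d3] by (auto simp: \<phi>_def active_def)
  ultimately show ?thesis
    using ij t by (metis order_trans zero_le_one)
qed

end

section \<open>Degrees of signature ppn\<close>

lemma sum_of_bool_eq_mult:
  fixes f :: "'a \<Rightarrow> 'b::semiring_1"
  assumes "finite U" "v \<notin> U \<Longrightarrow> f v = 0"
  shows "(\<Sum>u\<in>U. of_bool (u = v) * f u) = f v"
proof -
  have "(\<Sum>u\<in>U. of_bool (u = v) * f u) = (\<Sum>u\<in>U. if u = v then f v else 0)"
    by (rule sum.cong) auto
  then show ?thesis using assms by auto
qed

context staircase
begin

section \<open>Columns of the staircase\<close>

definition height :: "int \<Rightarrow> int \<Rightarrow> int" where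
  "height y z = int (card {x. N x y z})"

text \<open>By \<open>down\<close> a column is an initial segment of the nonnegative integers, so
  its cardinality is the first exponent outside \<open>N\<close>. Columns with a negative index get
  height 0.\<close>

lemma N_iff_height: "N x y z \<longleftrightarrow> 0 \<le> x \<and> x < height y z"
proof (cases "{x. N x y z} = {}")
  case False
  define m where "m = Max {x. N x y z}"
  have fin: "finite {x. N x y z}"
  proof (rule finite_subset)
    show "{x. N x y z} \<subseteq> {0..M}"
    proof clarify
      fix x assume "N x y z"
      from nonneg[OF this] bounded[OF this] show "x \<in> {0..M}" by simp
    qed
  qed simp
  have m: "N m y z" "\<And>x. N x y z \<Longrightarrow> x \<le> m"
    using Max_in[OF fin False] Max_ge[OF fin] by (auto simp: m_def)
  have "{x. N x y z} = {0..m}"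
    using nonneg[OF m(1)] m nonneg by (auto intro: down[OF m(1)])
  then have "height y z = m + 1" "N x y z \<longleftrightarrow> x \<in> {0..m}"
    using nonneg[OF m(1)] by (auto simp: height_def)
  then show ?thesis by auto
qed (auto simp: height_def)

lemma height_nonneg: "0 \<le> height y z"
  by (simp add: height_def)

lemma height_pos:
  assumes "0 < height y z"
  shows "0 \<le> y" "0 \<le> z" "y < M" "z < M" "height y z \<le> M"
proof -
  have "N 0 y z" "N (height y z - 1) y z" using assms by (auto simp: N_iff_height)
  then show "0 \<le> y" "0 \<le> z" "y < M" "z < M" "height y z \<le> M"
    using nonneg bounded by force+
qed

lemma height_antimono:
  assumes "0 \<le> y" "0 \<le> z" "y \<le> y'" "z \<le> z'"
  shows "height y' z' \<le> height y z"
proof (rule ccontr)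
  assume "\<not> ?thesis"
  then have "N (height y z) y' z'" by (simp add: N_iff_height height_nonneg)
  then have "N (height y z) y z" using assms by (rule_tac down) (auto simp: height_nonneg)
  then show False by (simp add: N_iff_height)
qed

text \<open>For \<open>0 \<le> a\<close> there are two readings. Among the columns with
  \<open>a < height y z\<close>, \<open>e1 \<le> y\<close> and \<open>e2 \<le> z\<close>, these are
  the ones that receive no monomial of the ideal from column \<open>(y - e1, z - e2)\<close> in
  degree \<open>(a, e1, e2)\<close>. Equivalently, the lowest ideal point
  \<open>(height y z, y, z)\<close>, moved by \<open>(- a - 1, - e1, - e2)\<close>, lies in
  \<open>N\<close>. The first reading serves signature ppn, the second the dual degree.\<close>

definition slab :: "int \<Rightarrow> int \<Rightarrow> int \<Rightarrow> (int \<times> int) set" where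
  "slab a e1 e2 = {(y, z). a < height y z \<and> height y z \<le> height (y - e1) (z - e2) + a}"

lemma finite_slab:
  assumes "0 \<le> a"
  shows "finite (slab a e1 e2)"
proof (rule finite_subset)
  show "slab a e1 e2 \<subseteq> {0..M} \<times> {0..M}"
  proof clarify
    fix y z assume "(y, z) \<in> slab a e1 e2"
    then have "0 < height y z" using assms by (simp add: slab_def)
    from height_pos[OF this] show "y \<in> {0..M} \<and> z \<in> {0..M}" by simp
  qed
qed simp

section \<open>The linear system in one degree of signature ppn\<close>

context
  fixes a1 a2 a3 :: int
  assumes a1: "0 \<le> a1" and a2: "0 \<le> a2" and a3: "a3 < 0"
begin

text \<open>
  A homomorphism of degree \<open>(a1, a2, a3)\<close> is given by coefficients \<open>u y z\<close> that depend on the target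
  column only. The unknowns \<open>(True, y, z)\<close> and \<open>(False, y, z)\<close> are the differences
  \<open>u (y - 1) z - u y z\<close> and \<open>u y (z - 1) - u y z\<close>; the equations say that the differences around a
  unit square add up to 0, and that \<open>u\<close> vanishes on the columns in \<open>slab a1 a2 a3\<close>.
\<close>

definition unknowns :: "(bool \<times> int \<times> int) set" where
  "unknowns = {True} \<times> slab a1 (a2 + 1) a3 \<union> {False} \<times> slab a1 a2 (a3 + 1)"

definition equations :: "(bool \<times> int \<times> int) set" where
  "equations = {True} \<times> slab a1 (a2 + 1) (a3 + 1) \<union> {False} \<times> slab a1 a2 a3"

definition coeff_matrix :: "bool \<times> int \<times> int \<Rightarrow> bool \<times> int \<times> int \<Rightarrow> 'k::field" where
  "coeff_matrix q u = (case q of (b, y, z) \<Rightarrow>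
    if b then of_bool (u = (True, y, z - 1)) - of_bool (u = (True, y, z))
      - of_bool (u = (False, y - 1, z)) + of_bool (u = (False, y, z))
    else (\<Sum>t\<in>{0..z}. of_bool (u = (False, y, t))))"

text \<open>The z-differences are summed from row \<open>-1\<close>, where the value is 0. Since
  \<open>a3 < 0\<close>, targets in that row do arise from nonnegative exponents, and a target with
  a negative exponent forces the coefficient 0.\<close>

definition column_coeff :: "(bool \<times> int \<times> int \<Rightarrow> 'k::field) \<Rightarrow> int \<Rightarrow> int \<Rightarrow> 'k" where
  "column_coeff s y z = - (\<Sum>t\<in>{0..z}. s (False, y, t))"

definition solution_hom :: "(bool \<times> int \<times> int \<Rightarrow> 'k::field) \<Rightarrow> int \<Rightarrow> int \<Rightarrow> int \<Rightarrow> 'k" where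
  "solution_hom s x y z =
    (if 0 \<le> x \<and> 0 \<le> y \<and> 0 \<le> z \<and> \<not> N x y z \<and> N (x + a1) (y + a2) (z + a3)
     then column_coeff s (y + a2) (z + a3) else 0)"

lemma finite_unknowns: "finite unknowns" and finite_equations: "finite equations"
  using a1 by (auto simp: unknowns_def equations_def finite_slab)

lemma card_unknowns: "card unknowns = card (slab a1 (a2 + 1) a3) + card (slab a1 a2 (a3 + 1))"
  and card_equations: "card equations = card (slab a1 (a2 + 1) (a3 + 1)) + card (slab a1 a2 a3)"
  unfolding unknowns_def equations_def
  by (subst card_Un_disjoint; use a1 in \<open>auto simp: finite_slab card_cartesian_product\<close>)+

lemma slabD:
  assumes "(y, z) \<in> slab a1 e1 e2"
  shows "a1 < height y z" "height y z \<le> height (y - e1) (z - e2) + a1"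
    "0 \<le> y" "0 \<le> z" "e1 \<le> y" "e2 \<le> z"
  using assms a1 height_pos[of y z] height_pos[of "y - e1" "z - e2"] unfolding slab_def by auto

context
  fixes s :: "bool \<times> int \<times> int \<Rightarrow> 'k::field"
  assumes outside: "\<And>u. u \<notin> unknowns \<Longrightarrow> s u = 0"
    and sol: "\<And>q. q \<in> equations \<Longrightarrow> (\<Sum>u\<in>unknowns. coeff_matrix q u * s u) = 0"
begin

lemma square_equation:
  assumes "(y, z) \<in> slab a1 (a2 + 1) (a3 + 1)"
  shows "s (True, y, z - 1) - s (True, y, z) - s (False, y - 1, z) + s (False, y, z) = 0"
proof -
  have pick: "(\<Sum>u\<in>unknowns. of_bool (u = v) * s u) = s v" for v
    using finite_unknowns outside by (rule sum_of_bool_eq_mult)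
  have "(\<Sum>u\<in>unknowns. coeff_matrix (True, y, z) u * s u) =
      s (True, y, z - 1) - s (True, y, z) - s (False, y - 1, z) + s (False, y, z)"
    by (simp add: coeff_matrix_def sum.distrib sum_subtractf left_diff_distrib distrib_right pick)
  then show ?thesis using sol[of "(True, y, z)"] assms by (simp add: equations_def)
qed

lemma column_coeff_eq_0:
  assumes "(y, z) \<in> slab a1 a2 a3"
  shows "column_coeff s y z = 0"
proof -
  have pick: "(\<Sum>u\<in>unknowns. of_bool (u = v) * s u) = s v" for v
    using finite_unknowns outside by (rule sum_of_bool_eq_mult)
  have "(\<Sum>u\<in>unknowns. coeff_matrix (False, y, z) u * s u) = (\<Sum>t\<in>{0..z}. s (False, y, t))"
  proof -
    have "(\<Sum>u\<in>unknowns. coeff_matrix (False, y, z) u * s u) =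
        (\<Sum>u\<in>unknowns. \<Sum>t\<in>{0..z}. of_bool (u = (False, y, t)) * s u)"
      by (simp only: coeff_matrix_def prod.case if_False sum_distrib_right)
    also have "\<dots> = (\<Sum>t\<in>{0..z}. \<Sum>u\<in>unknowns. of_bool (u = (False, y, t)) * s u)"
      by (rule sum.swap)
    finally show ?thesis by (simp only: pick)
  qed
  then show ?thesis
    using sol[of "(False, y, z)"] assms by (simp add: equations_def column_coeff_def)
qed

lemma column_coeff_neg: "z < 0 \<Longrightarrow> column_coeff s y z = 0"
  by (simp add: column_coeff_def)

lemma diff_z:
  assumes "0 \<le> z"
  shows "s (False, y, z) = column_coeff s y (z - 1) - column_coeff s y z"
proof -
  have "{0..z} = insert z {0..z - 1}" using assms by auto
  then show ?thesis by (simp add: column_coeff_def)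
qed

text \<open>Induction up the column from row \<open>-1\<close>, where all terms vanish. A square in
  \<open>equations\<close> passes the identity to the next row; for any other square all four
  differences are 0.\<close>

lemma diff_y:
  assumes "a2 + 1 \<le> y" "a1 < height y z"
  shows "s (True, y, z) = column_coeff s (y - 1) z - column_coeff s y z"
proof -
  have "z = -1 \<or> a1 < height y z \<Longrightarrow> s (True, y, z) = column_coeff s (y - 1) z - column_coeff s y z"
    if "-1 \<le> z" for z
    using that
  proof (induction z rule: int_ge_induct)
    case base
    have "(True, y, -1) \<notin> unknowns" by (auto simp: unknowns_def dest: slabD(4))
    then show ?case by (simp add: outside column_coeff_neg)
  next
    case (step z)
    then have h: "a1 < height y (z + 1)" by auto
    have "z = -1 \<or> a1 < height y z"
      using h height_antimono[of y z y "z + 1"] assms(1) a2 step.hyps by force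
    note IH = step.IH[OF this]
    have "s (True, y, z) - s (True, y, z + 1) - s (False, y - 1, z + 1) + s (False, y, z + 1) = 0"
    proof (cases "(y, z + 1) \<in> slab a1 (a2 + 1) (a3 + 1)")
      case True
      from square_equation[OF this] show ?thesis by simp
    next
      case False
      \<comment> \<open>This strict gap says that the square is not in its slab. As
        \<open>height\<close> is antitone, the gap persists at the four sides, so none of them is an
        unknown.\<close>
      then have big: "height (y - a2 - 1) (z - a3) + a1 < height y (z + 1)"
        using h by (auto simp: slab_def algebra_simps)
      have "(y, z) \<notin> slab a1 (a2 + 1) a3"
        using big height_antimono[of y z y "z + 1"] slabD[of y z "a2 + 1" a3]
        by (force simp: algebra_simps)
      moreover have "(y, z + 1) \<notin> slab a1 (a2 + 1) a3"
        using big height_antimono[of "y - a2 - 1" "z - a3" "y - a2 - 1" "z + 1 - a3"] assms(1)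
          slabD(2)[of y "z + 1" "a2 + 1" a3] step.hyps a3 by (force simp: algebra_simps)
      moreover have "(y - 1, z + 1) \<notin> slab a1 a2 (a3 + 1)"
        using big height_antimono[of "y - 1" "z + 1" y "z + 1"] assms(1) a2
          slabD(2)[of "y - 1" "z + 1" a2 "a3 + 1"] step.hyps by (force simp: algebra_simps)
      moreover have "(y, z + 1) \<notin> slab a1 a2 (a3 + 1)"
        using big height_antimono[of "y - a2 - 1" "z - a3" "y - a2" "z - a3"] assms(1)
          slabD(2)[of y "z + 1" a2 "a3 + 1"] step.hyps a3 by (force simp: algebra_simps)
      ultimately show ?thesis by (simp add: outside unknowns_def)
    qed
    then have "s (True, y, z + 1) = s (True, y, z) - s (False, y - 1, z + 1) + s (False, y, z + 1)"
      by (simp add: algebra_simps)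
    then show ?case using step.hyps by (simp add: IH diff_z)
  qed
  then show ?thesis using assms height_pos[of y z] a1 by auto
qed

text \<open>An x-step stays in one column. A y-step or z-step from an ideal monomial to one with
  target in \<open>N\<close> puts the corresponding difference outside its slab, so that difference
  is 0.\<close>

lemma hom_coeffs_solution_hom: "hom_coeffs N a1 a2 a3 (solution_hom s)"
proof (rule hom_coeffs_stepI)
  fix x y z assume "solution_hom s x y z \<noteq> 0"
  then show "0 \<le> x \<and> 0 \<le> y \<and> 0 \<le> z \<and> \<not> N x y z \<and> N (x + a1) (y + a2) (z + a3)"
    by (auto simp: solution_hom_def split: if_splits)
next
  fix x y z assume A: "0 \<le> x" "0 \<le> y" "0 \<le> z" "\<not> N x y z" "N (x + 1 + a1) (y + a2) (z + a3)"
  have "N (x + a1) (y + a2) (z + a3)" "\<not> N (x + 1) y z"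
    using A a1 nonneg[OF A(5)] by (auto simp: N_iff_height)
  then show "solution_hom s x y z = solution_hom s (x + 1) y z"
    using A by (simp add: solution_hom_def)
next
  fix x y z assume A: "0 \<le> x" "0 \<le> y" "0 \<le> z" "\<not> N x y z" "N (x + a1) (y + 1 + a2) (z + a3)"
  have N: "N (x + a1) (y + a2) (z + a3)" "\<not> N x (y + 1) z"
    using A a1 a2 nonneg[OF A(5)] by (auto intro: down[OF A(5)] dest: down[of x "y + 1" z x y z])
  have h: "height y z + a1 < height (y + 1 + a2) (z + a3)"
    using A by (auto simp: N_iff_height)
  then have "(y + 1 + a2, z + a3) \<notin> slab a1 (a2 + 1) a3"
    using slabD(2)[of "y + 1 + a2" "z + a3" "a2 + 1" a3] by auto
  then have "s (True, y + 1 + a2, z + a3) = 0" by (intro outside) (simp add: unknowns_def)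
  with diff_y[of "y + 1 + a2" "z + a3"] h height_nonneg[of y z] A
  have "column_coeff s (y + a2) (z + a3) = column_coeff s (y + 1 + a2) (z + a3)"
    by (simp add: algebra_simps)
  then show "solution_hom s x y z = solution_hom s x (y + 1) z"
    using A N by (simp add: solution_hom_def)
next
  fix x y z assume A: "0 \<le> x" "0 \<le> y" "0 \<le> z" "\<not> N x y z" "N (x + a1) (y + a2) (z + 1 + a3)"
  have N: "\<not> N x y (z + 1)" using A by (auto dest: down[of x y "z + 1" x y z])
  have N': "N (x + a1) (y + a2) (z + a3)" if "0 \<le> z + a3"
    using nonneg[OF A(5)] that by (auto intro: down[OF A(5)])
  have h: "height y z + a1 < height (y + a2) (z + 1 + a3)"
    using A by (auto simp: N_iff_height)
  then have "(y + a2, z + 1 + a3) \<notin> slab a1 a2 (a3 + 1)"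
    using slabD(2)[of "y + a2" "z + 1 + a3" a2 "a3 + 1"] by auto
  then have "s (False, y + a2, z + 1 + a3) = 0" by (intro outside) (simp add: unknowns_def)
  with diff_z[of "z + 1 + a3" "y + a2"] nonneg[OF A(5)]
  have eq: "column_coeff s (y + a2) (z + a3) = column_coeff s (y + a2) (z + 1 + a3)"
    by (simp add: algebra_simps)
  show "solution_hom s x y z = solution_hom s x y (z + 1)"
  proof (cases "0 \<le> z + a3")
    case True
    then show ?thesis using A N N' eq by (simp add: solution_hom_def)
  next
    \<comment> \<open>Here \<open>z + a3 = -1\<close>, and the default value 0 of
      \<open>column_coeff\<close> below row 0 is exactly what the step demands.\<close>
    case False
    then show ?thesis using nonneg A N eq column_coeff_neg[of "z + a3"]
      by (auto simp: solution_hom_def)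
  qed
qed

text \<open>A column that receives some ideal monomial shows its value in the homomorphism. The
  columns invisible there form \<open>slab a1 a2 a3\<close>; the second kind of equation sets them
  to 0. All unknowns are then differences of zeros.\<close>

lemma solution_hom_eq_0D:
  assumes zero: "\<And>x y z. solution_hom s x y z = 0"
  shows "s u = 0"
proof (cases "u \<in> unknowns")
  case True
  have c: "column_coeff s y z = 0" if "a2 \<le> y" "a1 < height y z" for y z
  proof (cases "(y, z) \<in> slab a1 a2 a3")
    case True
    then show ?thesis by (rule column_coeff_eq_0)
  next
    case False
    have "\<not> N (height (y - a2) (z - a3)) (y - a2) (z - a3)"
      by (simp add: N_iff_height)
    moreover have "N (height (y - a2) (z - a3) + a1) y z"
      using False that(2) a1 height_nonneg by (auto simp: N_iff_height slab_def)
    ultimately show ?thesis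
      using zero[of "height (y - a2) (z - a3)" "y - a2" "z - a3"] that a1 a3 height_pos(2)[of y z]
      by (simp add: solution_hom_def height_nonneg)
  qed
  show ?thesis
  proof -
    obtain b y z where u: "u = (b, y, z)" by (cases u)
    show ?thesis
    proof (cases b)
      case True
      with \<open>u \<in> unknowns\<close> have B: "(y, z) \<in> slab a1 (a2 + 1) a3" by (auto simp: unknowns_def u)
      note D = slabD[OF B]
      have "height y z \<le> height (y - 1) z" using D a2 by (intro height_antimono) auto
      with D c[of y z] c[of "y - 1" z] diff_y[of y z] show ?thesis by (simp add: u True)
    next
      case False
      with \<open>u \<in> unknowns\<close> have B: "(y, z) \<in> slab a1 a2 (a3 + 1)" by (auto simp: unknowns_def u)
      note D = slabD[OF B]
      have "column_coeff s y (z - 1) = 0"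
      proof (cases "z = 0")
        case False
        then have "height y z \<le> height y (z - 1)" using D by (intro height_antimono) auto
        with D show ?thesis by (intro c) auto
      qed (simp add: column_coeff_neg)
      with D c[of y z] diff_z[of z y] show ?thesis by (simp add: u False)
    qed
  qed
qed (rule outside)

end

text \<open>\<open>solution_hom\<close> is linear in the solution and has trivial kernel by
  \<open>solution_hom_eq_0D\<close>, so it preserves independence; the index set is merely
  renumbered.\<close>

lemma indep_homs_of_solutions:
  fixes s :: "bool \<times> int \<times> int \<Rightarrow> bool \<times> int \<times> int \<Rightarrow> 'k::field"
  assumes J: "finite J" and s: "independent_solutions coeff_matrix unknowns equations J s"
  shows "\<exists>r :: nat \<Rightarrow> int \<Rightarrow> int \<Rightarrow> int \<Rightarrow> 'k. indep_homs N a1 a2 a3 (card J) r"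
proof -
  obtain e where e: "bij_betw e {..<card J} J"
    using ex_bij_betw_nat_finite[OF J] by (auto simp: atLeast0LessThan)
  have eJ: "e k \<in> J" if "k < card J" for k
    using e that by (auto simp: bij_betw_def)
  have out: "s j u = 0" if "j \<in> J" "u \<notin> unknowns" for j u
    using s that unfolding independent_solutions_def by blast
  have sol: "(\<Sum>u\<in>unknowns. coeff_matrix q u * s j u) = 0" if "j \<in> J" "q \<in> equations" for j q
    using s that unfolding independent_solutions_def by blast
  have "indep_homs N a1 a2 a3 (card J) (\<lambda>k. solution_hom (s (e k)))"
    unfolding indep_homs_def
  proof (intro conjI allI impI)
    fix k assume "k < card J"
    with eJ show "hom_coeffs N a1 a2 a3 (solution_hom (s (e k)))"
      by (intro hom_coeffs_solution_hom out sol)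
  next
    fix c :: "nat \<Rightarrow> 'k" and k
    assume c: "\<forall>x y z. (\<Sum>j<card J. c j * solution_hom (s (e j)) x y z) = 0" and k: "k < card J"
    define d where "d j = c (inv_into {..<card J} e j)" for j
    have de: "d (e i) = c i" if "i < card J" for i
      using e that by (auto simp: d_def bij_betw_def inv_into_f_f)
    have reindex: "(\<Sum>i<card J. c i * g (e i)) = (\<Sum>j\<in>J. d j * g j)" for g
      by (subst sum.reindex_bij_betw[OF e, symmetric]) (auto simp: de intro: sum.cong)
    define S where "S u = (\<Sum>j\<in>J. d j * s j u)" for u
    have "S u = 0" for u
    proof (rule solution_hom_eq_0D[of S])
      fix u assume "u \<notin> unknowns"
      then show "S u = 0" using out by (simp add: S_def)
    next
      fix q assume q: "q \<in> equations"
      have "(\<Sum>u\<in>unknowns. coeff_matrix q u * S u) =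
          (\<Sum>u\<in>unknowns. \<Sum>j\<in>J. d j * (coeff_matrix q u * s j u))"
        by (simp add: S_def sum_distrib_left algebra_simps)
      also have "\<dots> = (\<Sum>j\<in>J. d j * (\<Sum>u\<in>unknowns. coeff_matrix q u * s j u))"
        by (subst sum.swap) (simp add: sum_distrib_left)
      finally show "(\<Sum>u\<in>unknowns. coeff_matrix q u * S u) = 0" using sol q by simp
    next
      fix x y z
      have col: "column_coeff S v w = (\<Sum>j\<in>J. d j * column_coeff (s j) v w)" for v w
        unfolding column_coeff_def S_def
        by (subst sum.swap) (simp add: sum_distrib_left sum_negf)
      have "solution_hom S x y z = (\<Sum>j\<in>J. d j * solution_hom (s j) x y z)"
      proof (cases "0 \<le> x \<and> 0 \<le> y \<and> 0 \<le> z \<and> \<not> N x y z \<and> N (x + a1) (y + a2) (z + a3)")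
        case True
        show ?thesis by (simp only: solution_hom_def if_P[OF True] col)
      next
        case False
        show ?thesis by (simp only: solution_hom_def if_not_P[OF False] mult_zero_right sum.neutral_const)
      qed
      also have "\<dots> = 0" using c reindex[of "\<lambda>j. solution_hom (s j) x y z"] by simp
      finally show "solution_hom S x y z = 0" .
    qed
    then have "\<forall>j\<in>J. d j = 0"
      using s unfolding independent_solutions_def S_def by blast
    with de[OF k] eJ[OF k] show "c k = 0" by metis
  qed
  then show ?thesis by blast
qed

lemma ex_ppn_homs:
  "\<exists>n (s :: nat \<Rightarrow> int \<Rightarrow> int \<Rightarrow> int \<Rightarrow> 'k::field). indep_homs N a1 a2 a3 n s \<and>
    card (slab a1 (a2 + 1) a3) + card (slab a1 a2 (a3 + 1)) \<le>
    n + card (slab a1 (a2 + 1) (a3 + 1)) + card (slab a1 a2 a3)"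
proof -
  obtain J s where J: "J \<subseteq> unknowns" "card unknowns \<le> card J + card equations"
    and s: "independent_solutions (coeff_matrix :: _ \<Rightarrow> _ \<Rightarrow> 'k) unknowns equations J s"
    using homogeneous_system_solutions[OF finite_unknowns finite_equations] by blast
  have "finite J" using J finite_unknowns finite_subset by blast
  from indep_homs_of_solutions[OF this s] J(2) show ?thesis
    by (auto simp: card_unknowns card_equations add.assoc)
qed

text \<open>
  The values of \<open>\<psi>\<close> at the lowest ideal point of each column are the coefficients of a linear
  relation between the equations for the unit squares, so one equation is redundant.
\<close>

lemma ex_ppn_homs_dual:
  fixes \<psi> :: "int \<Rightarrow> int \<Rightarrow> int \<Rightarrow> 'k::field"
  assumes \<psi>: "hom_coeffs N (- a1 - 1) (- a2 - 1) (- a3 - 1) \<psi>" and nz: "\<psi> x0 y0 z0 \<noteq> 0"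
  shows "\<exists>n (s :: nat \<Rightarrow> int \<Rightarrow> int \<Rightarrow> int \<Rightarrow> 'k::field). indep_homs N a1 a2 a3 n s \<and>
    card (slab a1 (a2 + 1) a3) + card (slab a1 a2 (a3 + 1)) + 1 \<le>
    n + card (slab a1 (a2 + 1) (a3 + 1)) + card (slab a1 a2 a3)"
proof -
  define B where "B = slab a1 (a2 + 1) (a3 + 1)"
  define \<psi>B where "\<psi>B y z = (if (y, z) \<in> B then \<psi> (height y z) y z else 0)" for y z
  have \<psi>0: "\<psi> x y z = 0" if "\<not> N (x - a1 - 1) (y - a2 - 1) (z - a3 - 1)" for x y z
    using hom_coeffs_nonzeroD(5)[OF \<psi>, of x y z] that by (auto simp: algebra_simps)
  have \<psi>eq: "\<psi> x y z = \<psi> x' y' z'"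
    if "0 \<le> y" "0 \<le> z" "0 \<le> x" "height y z \<le> x" "x \<le> x'" "y \<le> y'" "z \<le> z'"
      "N (x' - a1 - 1) (y' - a2 - 1) (z' - a3 - 1)" for x y z x' y' z'
    using hom_coeffs_eqD[OF \<psi>, of x y z x' y' z'] that
    by (auto simp: algebra_simps N_iff_height)
  have top: "\<psi> (height y z) y z = \<psi>B y z" if "a1 < height y z" for y z
  proof (cases "(y, z) \<in> B")
    case False
    with that have "\<not> N (height y z - a1 - 1) (y - a2 - 1) (z - a3 - 1)"
      by (auto simp: B_def slab_def N_iff_height algebra_simps)
    then show ?thesis using False by (simp add: \<psi>B_def \<psi>0)
  qed (simp add: \<psi>B_def)
  have col: "\<psi> x y z = \<psi>B y z"
    if "0 \<le> y" "0 \<le> z" "height y z \<le> x" "N (x - a1 - 1) (y - a2 - 1) (z - a3 - 1)" for x y z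
  proof (cases "a1 < height y z")
    case True
    have "\<psi> (height y z) y z = \<psi> x y z"
      using that height_nonneg by (intro \<psi>eq) auto
    with top[OF True] show ?thesis by simp
  next
    \<comment> \<open>The point at level \<open>a1\<close> is in the ideal, but its first target
      exponent is \<open>-1\<close>; so the value there, and with it the value at \<open>x\<close>,
      is 0.\<close>
    case False
    have "\<psi> a1 y z = \<psi> x y z"
      using that False nonneg[OF that(4)] a1 by (intro \<psi>eq) auto
    moreover have "\<psi> a1 y z = 0"
      by (intro \<psi>0) (simp add: N_iff_height)
    moreover have "(y, z) \<notin> B" using False by (auto simp: B_def dest: slabD)
    ultimately show ?thesis by (simp add: \<psi>B_def)
  qed
  \<comment> \<open>The unknown \<open>(True, y, z)\<close> borders the squares at
    \<open>(y, z)\<close> and \<open>(y, z + 1)\<close>. That it is an unknown means that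
    \<open>(height y z, y, z + 1)\<close> has its dual target in \<open>N\<close>, so
    \<open>\<psi>\<close> gives both squares the same weight; they enter with opposite
    signs.\<close>
  have rel1: "\<psi>B y (z + 1) = \<psi>B y z" if "(y, z) \<in> slab a1 (a2 + 1) a3" for y z
  proof -
    note D = slabD[OF that]
    have N: "N (height y z - a1 - 1) (y - a2 - 1) (z + 1 - a3 - 1)"
      using D by (auto simp: N_iff_height algebra_simps)
    have "\<psi> (height y z) y z = \<psi> (height y z) y (z + 1)"
      using D N height_nonneg by (intro \<psi>eq) auto
    also have "\<dots> = \<psi>B y (z + 1)"
      using D N height_antimono[of y z y "z + 1"] by (intro col) auto
    finally show ?thesis using top D by simp
  qed
  have rel2: "\<psi>B y z = \<psi>B (y + 1) z" if "(y, z) \<in> slab a1 a2 (a3 + 1)" for y z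
  proof -
    note D = slabD[OF that]
    have N: "N (height y z - a1 - 1) (y + 1 - a2 - 1) (z - a3 - 1)"
      using D by (auto simp: N_iff_height algebra_simps)
    have "\<psi> (height y z) y z = \<psi> (height y z) (y + 1) z"
      using D N height_nonneg by (intro \<psi>eq) auto
    also have "\<dots> = \<psi>B (y + 1) z"
      using D N height_antimono[of y z "y + 1" z] by (intro col) auto
    finally show ?thesis using top D by simp
  qed
  \<comment> \<open>Only the square equations take part in the relation; the equations for vanishing
    columns get weight 0.\<close>
  define \<psi>E where "\<psi>E = (\<lambda>(b, y, z). if b then \<psi> (height y z) y z else 0)"
  have N0: "N (x0 - a1 - 1) (y0 - a2 - 1) (z0 - a3 - 1)" using \<psi>0 nz by blast
  have "\<psi>B y0 z0 \<noteq> 0"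
    using col[OF _ _ _ N0] hom_coeffs_nonzeroD[OF \<psi> nz] nz by (auto simp: N_iff_height)
  then have q: "(True, y0, z0) \<in> equations" "\<psi>E (True, y0, z0) \<noteq> 0"
    by (auto simp: \<psi>B_def B_def equations_def \<psi>E_def split: if_splits)
  have fB: "finite B" using a1 by (simp add: B_def finite_slab)
  have rel: "(\<Sum>q\<in>equations. \<psi>E q * coeff_matrix q u) = 0" if u: "u \<in> unknowns" for u
  proof -
    have pick: "(\<Sum>v\<in>B. \<psi> (height (fst v) (snd v)) (fst v) (snd v) * of_bool (v = (y, z))) = \<psi>B y z" for y z
    proof -
      have "(\<Sum>v\<in>B. \<psi> (height (fst v) (snd v)) (fst v) (snd v) * of_bool (v = (y, z))) =
          (\<Sum>v\<in>B. of_bool (v = (y, z)) * \<psi>B (fst v) (snd v))"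
        by (rule sum.cong) (auto simp: \<psi>B_def)
      also have "\<dots> = \<psi>B (fst (y, z)) (snd (y, z))"
        using fB by (rule sum_of_bool_eq_mult) (simp add: \<psi>B_def)
      finally show ?thesis by simp
    qed
    have "(\<Sum>q\<in>equations. \<psi>E q * coeff_matrix q u) =
        (\<Sum>q\<in>{True} \<times> B. \<psi>E q * coeff_matrix q u)"
      using finite_equations
      by (intro sum.mono_neutral_right) (auto simp: equations_def B_def \<psi>E_def)
    also have "\<dots> = (\<Sum>v\<in>B. \<psi> (height (fst v) (snd v)) (fst v) (snd v) * coeff_matrix (True, v) u)"
      by (rule sum.reindex_bij_witness[of _ "\<lambda>v. (True, v)" snd]) (auto simp: \<psi>E_def)
    also have "\<dots> = 0"
    proof -
      obtain b y z where byz: "u = (b, y, z)" by (cases u)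
      show ?thesis
      proof (cases b)
        case True
        have "coeff_matrix (True, v) u = of_bool (v = (y, z + 1)) - (of_bool (v = (y, z)) :: 'k)" for v
          by (auto simp: byz True coeff_matrix_def split: prod.splits)
        moreover have "(y, z) \<in> slab a1 (a2 + 1) a3"
          using u by (auto simp: byz True unknowns_def)
        ultimately show ?thesis
          using rel1[of y z] by (simp add: right_diff_distrib sum_subtractf pick)
      next
        case False
        have "coeff_matrix (True, v) u = of_bool (v = (y, z)) - (of_bool (v = (y + 1, z)) :: 'k)" for v
          by (auto simp: byz False coeff_matrix_def split: prod.splits)
        moreover have "(y, z) \<in> slab a1 a2 (a3 + 1)"
          using u by (auto simp: byz False unknowns_def)
        ultimately show ?thesis
          using rel2[of y z] by (simp add: right_diff_distrib sum_subtractf pick)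
      qed
    qed
    finally show ?thesis .
  qed
  have "\<exists>J s. J \<subseteq> unknowns \<and> card unknowns + 1 \<le> card J + card equations \<and>
      independent_solutions (coeff_matrix :: _ \<Rightarrow> _ \<Rightarrow> 'k) unknowns equations J s"
    by (rule homogeneous_system_solutions_relation[where \<psi> = \<psi>E and q = "(True, y0, z0)"])
      (use finite_unknowns finite_equations q rel in auto)
  then obtain J s where J: "J \<subseteq> unknowns" "card unknowns + 1 \<le> card J + card equations"
    and s: "independent_solutions (coeff_matrix :: _ \<Rightarrow> _ \<Rightarrow> 'k) unknowns equations J s"
    by blast
  have "finite J" using J finite_unknowns finite_subset by blast
  from indep_homs_of_solutions[OF this s] J(2) show ?thesis
    by (auto simp: card_unknowns card_equations add.assoc)
qed

end

end

section \<open>Summing over degrees\<close>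

text \<open>The predicate \<open>P\<close> confines the degrees, so that families with incompatible
  signatures are visibly disjoint when they are united.\<close>

definition hom_family ::
  "(int \<Rightarrow> int \<Rightarrow> int \<Rightarrow> bool) \<Rightarrow> (int \<Rightarrow> int \<Rightarrow> int \<Rightarrow> bool) \<Rightarrow> (int \<times> int \<times> int) set \<Rightarrow>
    (int \<times> int \<times> int \<Rightarrow> nat) \<Rightarrow> (int \<times> int \<times> int \<Rightarrow> nat \<Rightarrow> int \<Rightarrow> int \<Rightarrow> int \<Rightarrow> 'k::field) \<Rightarrow> bool" where
  "hom_family N P S g s \<longleftrightarrow> finite S \<and>
    (\<forall>(a1, a2, a3)\<in>S. P a1 a2 a3 \<and> indep_homs N a1 a2 a3 (g (a1, a2, a3)) (s (a1, a2, a3)))"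

lemma indep_homs_single:
  assumes "hom_coeffs N a1 a2 a3 \<phi>" "\<phi> x y z \<noteq> 0"
  shows "indep_homs N a1 a2 a3 1 (\<lambda>_. \<phi>)"
  using assms unfolding indep_homs_def by (auto simp: less_Suc_eq)

section \<open>Cyclic rotation and union of families\<close>

lemma hom_coeffs_rotate:
  assumes "hom_coeffs (\<lambda>x y z. N z x y) a1 a2 a3 \<phi>"
  shows "hom_coeffs N a3 a1 a2 (\<lambda>x y z. \<phi> y z x)"
proof (rule hom_coeffsI)
  fix x y z assume "\<phi> y z x \<noteq> 0"
  from hom_coeffs_nonzeroD[OF assms this]
  show "0 \<le> x \<and> 0 \<le> y \<and> 0 \<le> z \<and> \<not> N x y z \<and> N (x + a3) (y + a1) (z + a2)"
    by simp
qed (use hom_coeffs_eqD[OF assms] in simp)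

lemma indep_homs_rotate:
  assumes "indep_homs (\<lambda>x y z. N z x y) a1 a2 a3 n s"
  shows "indep_homs N a3 a1 a2 n (\<lambda>j x y z. s j y z x)"
  using assms hom_coeffs_rotate[of N a1 a2 a3] unfolding indep_homs_def by blast

lemma hom_family_rotate:
  fixes s :: "int \<times> int \<times> int \<Rightarrow> nat \<Rightarrow> int \<Rightarrow> int \<Rightarrow> int \<Rightarrow> 'k::field"
  assumes fam: "hom_family (\<lambda>x y z. N z x y) P S g s"
  obtains S' g' and s' :: "int \<times> int \<times> int \<Rightarrow> nat \<Rightarrow> int \<Rightarrow> int \<Rightarrow> int \<Rightarrow> 'k"
  where "hom_family N (\<lambda>a1 a2 a3. P a2 a3 a1) S' g' s'" "sum g' S' = sum g S"
proof
  define rot :: "int \<times> int \<times> int \<Rightarrow> int \<times> int \<times> int" where "rot = (\<lambda>(a1, a2, a3). (a3, a1, a2))"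
  define unrot :: "int \<times> int \<times> int \<Rightarrow> int \<times> int \<times> int" where "unrot = (\<lambda>(a3, a1, a2). (a1, a2, a3))"
  have r: "P d1 d2 d3 \<and> indep_homs N d3 d1 d2 (g (d1, d2, d3)) (\<lambda>j x y z. s (d1, d2, d3) j y z x)"
    if "(d1, d2, d3) \<in> S" for d1 d2 d3
  proof -
    have "P d1 d2 d3 \<and> indep_homs (\<lambda>x y z. N z x y) d1 d2 d3 (g (d1, d2, d3)) (s (d1, d2, d3))"
      using fam that unfolding hom_family_def by fast
    with indep_homs_rotate[of N d1 d2 d3] show ?thesis by blast
  qed
  show "hom_family N (\<lambda>a1 a2 a3. P a2 a3 a1) (rot ` S) (g \<circ> unrot) (\<lambda>a j x y z. s (unrot a) j y z x)"
    using r fam unfolding hom_family_def by (auto simp: rot_def unrot_def)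
  show "sum (g \<circ> unrot) (rot ` S) = sum g S"
    by (rule sum.reindex_bij_witness[of _ rot unrot]) (auto simp: rot_def unrot_def)
qed

lemma hom_family_Un:
  fixes s s' :: "int \<times> int \<times> int \<Rightarrow> nat \<Rightarrow> int \<Rightarrow> int \<Rightarrow> int \<Rightarrow> 'k::field"
  assumes fam: "hom_family N P S g s" "hom_family N P' S' g' s'"
    and disj: "\<And>a1 a2 a3. P a1 a2 a3 \<Longrightarrow> P' a1 a2 a3 \<Longrightarrow> False"
  obtains T h and r :: "int \<times> int \<times> int \<Rightarrow> nat \<Rightarrow> int \<Rightarrow> int \<Rightarrow> int \<Rightarrow> 'k"
  where "hom_family N (\<lambda>a1 a2 a3. P a1 a2 a3 \<or> P' a1 a2 a3) T h r" "sum h T = sum g S + sum g' S'"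
proof
  define h where "h a = (if a \<in> S then g a else g' a)" for a
  have SS: "S \<inter> S' = {}" using fam disj unfolding hom_family_def by fast
  show "hom_family N (\<lambda>a1 a2 a3. P a1 a2 a3 \<or> P' a1 a2 a3) (S \<union> S') h (\<lambda>a. if a \<in> S then s a else s' a)"
    using fam unfolding hom_family_def h_def by auto
  have "sum h (S \<union> S') = sum h S + sum h S'"
    using fam SS by (intro sum.union_disjoint) (auto simp: hom_family_def)
  moreover have "sum h S = sum g S" by (rule sum.cong) (auto simp: h_def)
  moreover have "sum h S' = sum g' S'" using SS by (intro sum.cong) (auto simp: h_def)
  ultimately show "sum h (S \<union> S') = sum g S + sum g' S'" by simp
qed

context staircase
begin

section \<open>The telescoping count over all degrees\<close>

lemma slab_eq_empty:
  assumes "0 \<le> a" "M \<le> e1 \<or> M \<le> - e2"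
  shows "slab a e1 e2 = {}"
proof -
  have "(y, z) \<notin> slab a e1 e2" for y z
  proof
    assume *: "(y, z) \<in> slab a e1 e2"
    then have "0 < height y z" "0 < height (y - e1) (z - e2)"
      using assms by (auto simp: slab_def)
    from height_pos[OF this(1)] height_pos[OF this(2)] assms(2) show False by auto
  qed
  then show ?thesis by auto
qed

text \<open>\<open>slab (int i) 0 0\<close> is the layer of \<open>N\<close> with first exponent
  \<open>i\<close>.\<close>

lemma sum_card_columns:
  assumes "M \<le> int K"
  shows "(\<Sum>i<K. card (slab (int i) 0 0)) = card {(x, y, z). N x y z}"
proof -
  have "(\<Sum>i<K. card (slab (int i) 0 0)) = card (Sigma {..<K} (\<lambda>i. slab (int i) 0 0))"
    by (subst card_SigmaI) (auto simp: finite_slab)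
  also have "\<dots> = card {(x, y, z). N x y z}"
  proof (rule bij_betw_same_card[of "\<lambda>(i, y, z). (int i, y, z)"], rule bij_betw_byWitness[of _ "\<lambda>(x, y, z). (nat x, y, z)"])
    show "(\<lambda>(x, y, z). (nat x, y, z)) ` {(x, y, z). N x y z} \<subseteq> (SIGMA i:{..<K}. slab (int i) 0 0)"
    proof clarify
      fix x y z assume N: "N x y z"
      then have "nat x < K" using assms bounded[OF N] nonneg[OF N] by auto
      with N show "nat x \<in> {..<K} \<and> (y, z) \<in> slab (int (nat x)) 0 0"
        by (auto simp: N_iff_height slab_def)
    qed
    show "\<forall>a\<in>{(x, y, z). N x y z}. (\<lambda>(i, y, z). (int i, y, z)) ((\<lambda>(x, y, z). (nat x, y, z)) a) = a"
      by (auto simp: N_iff_height)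
  qed (auto simp: N_iff_height slab_def)
  finally show ?thesis .
qed

text \<open>The summand is a mixed second difference in \<open>(j, k)\<close>, where
  \<open>k\<close> stands for \<open>a3 = - 1 - k\<close>. Only the corner \<open>j = k = 0\<close>
  survives, because \<open>M \<le> int K\<close> empties the slabs on the far sides of the
  box.\<close>

lemma sum_euler_char:
  assumes K: "M \<le> int K"
  shows "(\<Sum>i<K. \<Sum>j<K. \<Sum>k<K.
      int (card (slab (int i) (int j + 1) (- 1 - int k))) + int (card (slab (int i) (int j) (- int k)))
      - int (card (slab (int i) (int j + 1) (- int k))) - int (card (slab (int i) (int j) (- 1 - int k))))
    = int (card {(x, y, z). N x y z})"
proof -
  define f where "f i j k = int (card (slab (int i) (int j) (- int k)))" for i j k
  have "(\<Sum>j<K. \<Sum>k<K. f i (Suc j) (Suc k) + f i j k - f i (Suc j) k - f i j (Suc k)) = f i 0 0" for i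
  proof -
    have 1: "(\<Sum>k<K. f i j (Suc k) - f i j k) = - f i j 0" for j
      using K by (subst sum_lessThan_telescope) (simp add: f_def slab_eq_empty)
    have "(\<Sum>j<K. \<Sum>k<K. f i (Suc j) (Suc k) + f i j k - f i (Suc j) k - f i j (Suc k)) =
        (\<Sum>j<K. (\<Sum>k<K. f i (Suc j) (Suc k) - f i (Suc j) k) - (\<Sum>k<K. f i j (Suc k) - f i j k))"
      by (subst sum_subtractf[symmetric]) (intro sum.cong refl, simp)
    also have "\<dots> = - (\<Sum>j<K. f i (Suc j) 0 - f i j 0)"
      by (simp add: 1 sum_negf[symmetric])
    also have "\<dots> = f i 0 0"
      using K by (subst sum_lessThan_telescope) (simp add: f_def slab_eq_empty)
    finally show ?thesis .
  qed
  then have "(\<Sum>i<K. \<Sum>j<K. \<Sum>k<K. f i (Suc j) (Suc k) + f i j k - f i (Suc j) k - f i j (Suc k)) =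
      int (\<Sum>i<K. card (slab (int i) 0 0))"
    by (simp add: f_def)
  also have "\<dots> = int (card {(x, y, z). N x y z})" using sum_card_columns[OF K] by simp
  finally show ?thesis by (simp add: f_def algebra_simps)
qed

lemma ex_hom_family_ppn_nnp:
  assumes a: "socle_point N a1 a2 a3" and b: "socle_point N b1 b2 b3" and c: "socle_point N c1 c2 c3"
    and triple: "b1 < a1" "c1 < a1" "a2 < b2" "c2 < b2" "a3 < c3" "b3 < c3"
  obtains S g and s :: "int \<times> int \<times> int \<Rightarrow> nat \<Rightarrow> int \<Rightarrow> int \<Rightarrow> int \<Rightarrow> 'k::field"
  where "hom_family N (\<lambda>a1 a2 a3. 0 \<le> a1 \<and> 0 \<le> a2 \<and> a3 < 0 \<or> a1 < 0 \<and> a2 < 0 \<and> 0 \<le> a3) S g s"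
    "card {(x, y, z). N x y z} + 2 \<le> sum g S"
proof -
  obtain i j t and \<phi> :: "int \<Rightarrow> int \<Rightarrow> int \<Rightarrow> 'k" and x y z
    where ijt: "1 \<le> i" "1 \<le> j" "0 \<le> t" and \<phi>: "hom_coeffs N (- i) (- j) t \<phi>" "\<phi> x y z \<noteq> 0"
    using ex_nonzero_nnp_hom[OF a b c triple, where 'k = 'k] by blast
  \<comment> \<open>The box has to reach \<open>M\<close> for the telescoping and has to contain the
    dual degree \<open>p\<close>.\<close>
  define K where "K = nat (max M (max i (max j (t + 1))))"
  have K: "M \<le> int K" "i \<le> int K" "j \<le> int K" "t < int K" using ijt by (auto simp: K_def)
  define deg :: "nat \<times> nat \<times> nat \<Rightarrow> int \<times> int \<times> int" where
    "deg = (\<lambda>(i, j, k). (int i, int j, - 1 - int k))"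
  define box where "box = deg ` ({..<K} \<times> {..<K} \<times> {..<K})"
  define chi where "chi = (\<lambda>(a1, a2, a3).
      int (card (slab a1 (a2 + 1) a3)) + int (card (slab a1 a2 (a3 + 1)))
      - int (card (slab a1 (a2 + 1) (a3 + 1))) - int (card (slab a1 a2 a3)))"
  \<comment> \<open>This is \<open>- (-i, -j, t) - (1, 1, 1)\<close>, the degree dual to that of
    \<open>\<phi>\<close>.\<close>
  define p where "p = (i - 1, j - 1, - t - 1)"
  have inj: "inj deg" by (auto simp: deg_def inj_def)
  have p: "p \<in> box" unfolding box_def
    using K ijt by (intro image_eqI[of _ _ "(nat (i - 1), nat (j - 1), nat t)"])
      (auto simp: p_def deg_def)
  have "\<exists>n (r :: nat \<Rightarrow> int \<Rightarrow> int \<Rightarrow> int \<Rightarrow> 'k). (case q of (d1, d2, d3) \<Rightarrow> indep_homs N d1 d2 d3 n r) \<and>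
      chi q + of_bool (q = p) \<le> int n" if q: "q \<in> box" for q
  proof -
    obtain d1 d2 d3 where d: "q = (d1, d2, d3)" "0 \<le> d1" "0 \<le> d2" "d3 < 0"
      using q by (auto simp: box_def deg_def)
    show ?thesis
    proof (cases "q = p")
      case True
      have "hom_coeffs N (- d1 - 1) (- d2 - 1) (- d3 - 1) \<phi>"
        using \<phi>(1) True by (auto simp: p_def d)
      from ex_ppn_homs_dual[OF d(2-4) this \<phi>(2)] True d show ?thesis
        by (force simp: chi_def)
    next
      case False
      from ex_ppn_homs[OF d(2-4), where 'k = 'k] False d show ?thesis
        by (force simp: chi_def)
    qed
  qed
  then obtain n and r :: "int \<times> int \<times> int \<Rightarrow> nat \<Rightarrow> int \<Rightarrow> int \<Rightarrow> int \<Rightarrow> 'k"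
    where nr: "\<And>q. q \<in> box \<Longrightarrow> case q of (d1, d2, d3) \<Rightarrow> indep_homs N d1 d2 d3 (n q) (r q)"
      "\<And>q. q \<in> box \<Longrightarrow> chi q + of_bool (q = p) \<le> int (n q)"
    by metis
  have "int (card {(x, y, z). N x y z}) = (\<Sum>i<K. \<Sum>j<K. \<Sum>k<K. chi (deg (i, j, k)))"
    using sum_euler_char[OF K(1)] by (simp add: chi_def deg_def algebra_simps)
  also have "\<dots> = sum (chi \<circ> deg) ({..<K} \<times> {..<K} \<times> {..<K})"
    by (simp add: sum.cartesian_product case_prod_unfold)
  also have "\<dots> = sum chi box"
    unfolding box_def by (rule sum.reindex[symmetric]) (rule inj_on_subset[OF inj subset_UNIV])
  finally have "int (card {(x, y, z). N x y z}) + 1 = sum chi box + (\<Sum>q\<in>box. of_bool (q = p))"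
    using p by (simp add: of_bool_def box_def)
  also have "\<dots> \<le> (\<Sum>q\<in>box. int (n q))"
    unfolding sum.distrib[symmetric] by (rule sum_mono) (rule nr(2))
  finally have sum: "card {(x, y, z). N x y z} + 1 \<le> sum n box" 
    by (simp flip: of_nat_sum)
  have fam1: "hom_family N (\<lambda>a1 a2 a3. 0 \<le> a1 \<and> 0 \<le> a2 \<and> a3 < 0) box n r"
    unfolding hom_family_def using nr(1) by (fastforce simp: box_def deg_def)
  have fam2: "hom_family N (\<lambda>a1 a2 a3. a1 < 0 \<and> a2 < 0 \<and> 0 \<le> a3) {(-i, -j, t)} (\<lambda>_. 1) (\<lambda>_ _. \<phi>)"
    unfolding hom_family_def using ijt indep_homs_single[OF \<phi>] by auto
  obtain T h and u :: "int \<times> int \<times> int \<Rightarrow> nat \<Rightarrow> int \<Rightarrow> int \<Rightarrow> int \<Rightarrow> 'k" where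
    "hom_family N (\<lambda>a1 a2 a3. 0 \<le> a1 \<and> 0 \<le> a2 \<and> a3 < 0 \<or> a1 < 0 \<and> a2 < 0 \<and> 0 \<le> a3) T h u"
    "sum h T = sum n box + sum (\<lambda>_. 1) {(-i, -j, t)}"
    by (rule hom_family_Un[OF fam1 fam2]) auto
  with sum show thesis by (intro that[of T h u]) auto
qed

end

lemma staircase_rotate:
  assumes "staircase N M"
  shows "staircase (\<lambda>x y z. N z x y) M"
proof -
  interpret staircase N M by fact
  show ?thesis
    by unfold_locales (use nonneg bounded down in blast)+
qed

lemma socle_point_rotate:
  assumes "socle_point N x y z"
  shows "socle_point (\<lambda>x y z. N z x y) y z x"
  using assms unfolding socle_point_def by blast

lemma card_rotate: "card {(x, y, z). N z x y} = card {(x, y, z). N x y z}"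
  by (rule bij_betw_same_card[of "\<lambda>(x, y, z). (z, x, y)"],
      rule bij_betw_byWitness[of _ "\<lambda>(x, y, z). (y, z, x)"]) auto

lemma ex_hom_family:
  assumes N: "staircase N M"
    and a: "socle_point N a1 a2 a3" and b: "socle_point N b1 b2 b3" and c: "socle_point N c1 c2 c3"
    and triple: "b1 < a1" "c1 < a1" "a2 < b2" "c2 < b2" "a3 < c3" "b3 < c3"
  obtains S g and s :: "int \<times> int \<times> int \<Rightarrow> nat \<Rightarrow> int \<Rightarrow> int \<Rightarrow> int \<Rightarrow> 'k::field"
  where "hom_family N (\<lambda>_ _ _. True) S g s" "3 * card {(x, y, z). N x y z} + 6 \<le> sum g S"
proof -
  define N1 where "N1 = (\<lambda>x y z. N z x y)"
  define N2 where "N2 = (\<lambda>x y z. N1 z x y)"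
  \<comment> \<open>\<open>P\<close> says that the third sign differs from the two others, so its
    cyclic rotations exclude each other.\<close>
  define P :: "int \<Rightarrow> int \<Rightarrow> int \<Rightarrow> bool" where
    "P = (\<lambda>a1 a2 a3. 0 \<le> a1 \<and> 0 \<le> a2 \<and> a3 < 0 \<or> a1 < 0 \<and> a2 < 0 \<and> 0 \<le> a3)"
  have st: "staircase N1 M" "staircase N2 M"
    using N staircase_rotate unfolding N1_def N2_def by blast+
  have soc1: "socle_point N1 y z x" if "socle_point N x y z" for x y z
    using socle_point_rotate[OF that] by (simp add: N1_def)
  have soc2: "socle_point N2 z x y" if "socle_point N x y z" for x y z
    using socle_point_rotate[OF soc1[OF that]] by (simp add: N2_def)
  have card: "card {(x, y, z). N1 x y z} = card {(x, y, z). N x y z}"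
    "card {(x, y, z). N2 x y z} = card {(x, y, z). N x y z}"
    using card_rotate[of N] card_rotate[of N1] by (simp_all add: N1_def N2_def)
  obtain S0 g0 and s0 :: "int \<times> int \<times> int \<Rightarrow> nat \<Rightarrow> int \<Rightarrow> int \<Rightarrow> int \<Rightarrow> 'k"
    where fam0: "hom_family N P S0 g0 s0" "card {(x, y, z). N x y z} + 2 \<le> sum g0 S0"
    by (rule staircase.ex_hom_family_ppn_nnp[OF N a b c triple, folded P_def])
  \<comment> \<open>In the rotated coordinates \<open>(y, z, x)\<close> the first entry is largest
    at \<open>b\<close>, the second at \<open>c\<close> and the third at \<open>a\<close>; the
    triple is rotated accordingly.\<close>
  obtain S1 g1 and s1 :: "int \<times> int \<times> int \<Rightarrow> nat \<Rightarrow> int \<Rightarrow> int \<Rightarrow> int \<Rightarrow> 'k"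
    where fam1: "hom_family N1 P S1 g1 s1" "card {(x, y, z). N x y z} + 2 \<le> sum g1 S1"
    by (rule staircase.ex_hom_family_ppn_nnp[OF st(1) soc1[OF b] soc1[OF c] soc1[OF a]
          triple(4,3,6,5,1,2), folded P_def, unfolded card])
  obtain S2 g2 and s2 :: "int \<times> int \<times> int \<Rightarrow> nat \<Rightarrow> int \<Rightarrow> int \<Rightarrow> int \<Rightarrow> 'k"
    where fam2: "hom_family N2 P S2 g2 s2" "card {(x, y, z). N x y z} + 2 \<le> sum g2 S2"
    by (rule staircase.ex_hom_family_ppn_nnp[OF st(2) soc2[OF c] soc2[OF a] soc2[OF b]
          triple(5,6,2,1,4,3), folded P_def, unfolded card])
  obtain S1' g1' and s1' :: "int \<times> int \<times> int \<Rightarrow> nat \<Rightarrow> int \<Rightarrow> int \<Rightarrow> int \<Rightarrow> 'k"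
    where fam1': "hom_family N (\<lambda>a1 a2 a3. P a2 a3 a1) S1' g1' s1'" "sum g1' S1' = sum g1 S1"
    by (rule hom_family_rotate[OF fam1(1)[unfolded N1_def]])
  obtain S2' g2' and s2' :: "int \<times> int \<times> int \<Rightarrow> nat \<Rightarrow> int \<Rightarrow> int \<Rightarrow> int \<Rightarrow> 'k"
    where fam2': "hom_family N1 (\<lambda>a1 a2 a3. P a2 a3 a1) S2' g2' s2'" "sum g2' S2' = sum g2 S2"
    by (rule hom_family_rotate[OF fam2(1)[unfolded N2_def]])
  obtain S2'' g2'' and s2'' :: "int \<times> int \<times> int \<Rightarrow> nat \<Rightarrow> int \<Rightarrow> int \<Rightarrow> int \<Rightarrow> 'k"
    where fam2'': "hom_family N (\<lambda>a1 a2 a3. P a3 a1 a2) S2'' g2'' s2''" "sum g2'' S2'' = sum g2' S2'"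
    by (rule hom_family_rotate[OF fam2'(1)[unfolded N1_def]])
  obtain T h and r :: "int \<times> int \<times> int \<Rightarrow> nat \<Rightarrow> int \<Rightarrow> int \<Rightarrow> int \<Rightarrow> 'k"
    where T: "hom_family N (\<lambda>a1 a2 a3. P a1 a2 a3 \<or> P a2 a3 a1) T h r" "sum h T = sum g0 S0 + sum g1' S1'"
    by (rule hom_family_Un[OF fam0(1) fam1'(1)]) (auto simp: P_def)
  obtain T' h' and r' :: "int \<times> int \<times> int \<Rightarrow> nat \<Rightarrow> int \<Rightarrow> int \<Rightarrow> int \<Rightarrow> 'k"
    where T': "hom_family N (\<lambda>a1 a2 a3. (P a1 a2 a3 \<or> P a2 a3 a1) \<or> P a3 a1 a2) T' h' r'"
      "sum h' T' = sum h T + sum g2'' S2''"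
    by (rule hom_family_Un[OF T(1) fam2''(1)]) (auto simp: P_def)
  show thesis
  proof (rule that)
    show "hom_family N (\<lambda>_ _ _. True) T' h' r'"
      using T'(1) unfolding hom_family_def by auto
    show "3 * card {(x, y, z). N x y z} + 6 \<le> sum h' T'"
      using T' T fam0 fam1 fam2 fam1' fam2' fam2'' by simp
  qed
qed

section \<open>Dimension and linear functionals\<close>

definition linear_functional :: "('k::field, 'v) module \<Rightarrow> ('v \<Rightarrow> 'k) \<Rightarrow> bool" where
  "linear_functional V f \<longleftrightarrow>
    (\<forall>v\<in>carrier V. \<forall>w\<in>carrier V. f (v \<oplus>\<^bsub>V\<^esub> w) = f v + f w) \<and>
    (\<forall>c. \<forall>v\<in>carrier V. f (c \<odot>\<^bsub>V\<^esub> v) = c * f v)"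

lemma base_field_simps:
  "carrier base_field = UNIV" "\<zero>\<^bsub>base_field\<^esub> = 0" "\<one>\<^bsub>base_field\<^esub> = 1"
  "x \<oplus>\<^bsub>base_field\<^esub> y = x + y" "x \<otimes>\<^bsub>base_field\<^esub> y = x * y"
  by (simp_all add: ring_of_type_algebra_def)

lemma functional_zero:
  assumes "vectorspace base_field V" "linear_functional V f"
  shows "f \<zero>\<^bsub>V\<^esub> = 0"
proof -
  interpret vectorspace base_field V by fact
  have "f (\<zero>\<^bsub>V\<^esub> \<oplus>\<^bsub>V\<^esub> \<zero>\<^bsub>V\<^esub>) = f \<zero>\<^bsub>V\<^esub> + f \<zero>\<^bsub>V\<^esub>"
    using assms(2) unfolding linear_functional_def by blast
  then show ?thesis using M.l_zero[OF M.zero_closed] by (metis add_cancel_right_right)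
qed

lemma functional_lincomb:
  assumes V: "vectorspace base_field V" and f: "linear_functional V f"
    and A: "finite A" "A \<subseteq> carrier V"
  shows "f (LinearCombinations.module.lincomb V c A) = (\<Sum>v\<in>A. c v * f v)"
proof -
  interpret vectorspace base_field V by fact
  have fin: "f (\<Oplus>\<^bsub>V\<^esub>v\<in>A. c v \<odot>\<^bsub>V\<^esub> v) = (\<Sum>v\<in>A. c v * f v)"
    using A
  proof induction
    case empty
    then show ?case using functional_zero[OF V f] by simp
  next
    case (insert v A)
    have c: "c v \<odot>\<^bsub>V\<^esub> v \<in> carrier V" if "v \<in> carrier V" for v
      using that by (simp add: base_field_simps)
    then have "(\<Oplus>\<^bsub>V\<^esub>v\<in>insert v A. c v \<odot>\<^bsub>V\<^esub> v) = c v \<odot>\<^bsub>V\<^esub> v \<oplus>\<^bsub>V\<^esub> (\<Oplus>\<^bsub>V\<^esub>v\<in>A. c v \<odot>\<^bsub>V\<^esub> v)"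
      using insert by (intro M.finsum_insert) auto
    moreover have "(\<Oplus>\<^bsub>V\<^esub>v\<in>A. c v \<odot>\<^bsub>V\<^esub> v) \<in> carrier V"
      using insert c by (intro M.finsum_closed) auto
    ultimately show ?case
      using insert f c by (simp add: linear_functional_def)
  qed
  then show ?thesis by (simp add: lincomb_def)
qed

text \<open>Functionals turn a linear relation between the vectors into scalar relations, which
  force all coefficients to be 0.\<close>

lemma card_le_dim_of_functionals:
  fixes v :: "'j \<Rightarrow> 'v" and V :: "('k::field, 'v) module"
  assumes V: "vectorspace base_field V" and fd: "vectorspace.fin_dim base_field V"
    and J: "finite J" and v: "\<And>j. j \<in> J \<Longrightarrow> v j \<in> carrier V"
    and L: "\<And>f. f \<in> L \<Longrightarrow> linear_functional V f"
    and indep: "\<And>c j. (\<And>f. f \<in> L \<Longrightarrow> (\<Sum>j\<in>J. c j * f (v j)) = 0) \<Longrightarrow> j \<in> J \<Longrightarrow> c j = 0"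
  shows "card J \<le> vectorspace.dim base_field V"
proof -
  interpret vectorspace base_field V by fact
  \<comment> \<open>\<open>lin_indpt\<close> concerns a set of vectors, so repetitions must be
    excluded before counting.\<close>
  have inj: "inj_on v J"
  proof (rule inj_onI, rule ccontr)
    fix i j assume ij: "i \<in> J" "j \<in> J" "v i = v j" "i \<noteq> j"
    have "(\<Sum>k\<in>J. (if k = i then 1 else if k = j then -1 else 0) * f (v k)) = 0" for f :: "'v \<Rightarrow> 'k"
    proof -
      have "(\<Sum>k\<in>J. (if k = i then 1 else if k = j then -1 else 0) * f (v k)) =
          (\<Sum>k\<in>{i, j}. (if k = i then 1 else if k = j then -1 else 0) * f (v k))"
        using J ij by (intro sum.mono_neutral_right) auto
      then show ?thesis using ij by simp
    qed
    from indep[OF this ij(1)] show False by simp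
  qed
  have "lin_indpt (v ` J)"
  proof (rule finite_lin_indpt2)
    fix a assume a: "lincomb a (v ` J) = \<zero>\<^bsub>V\<^esub>"
    have "(\<Sum>j\<in>J. a (v j) * f (v j)) = 0" if "f \<in> L" for f
    proof -
      have "(\<Sum>j\<in>J. a (v j) * f (v j)) = (\<Sum>w\<in>v ` J. a w * f w)"
        using inj by (simp add: sum.reindex)
      also have "\<dots> = f (lincomb a (v ` J))"
        using J v by (intro functional_lincomb[symmetric] V L that) auto
      finally show ?thesis by (simp add: a functional_zero[OF V L[OF that]])
    qed
    then show "\<forall>w\<in>v ` J. a w = \<zero>\<^bsub>base_field\<^esub>"
      using indep[of "\<lambda>j. a (v j)"] by (auto simp: base_field_simps)
  qed (use J v in auto)
  then have "card (v ` J) \<le> dim" using v by (intro li_le_dim fd) auto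
  with inj show ?thesis by (simp add: card_image)
qed

text \<open>Given more vectors than functionals, the homogeneous system that asks every functional
  to vanish on a combination has a nonzero solution, so the vectors are dependent. This bounds all
  independent sets, and a maximal one is a finite basis.\<close>

lemma dim_le_card_functionals:
  fixes V :: "('k::field, 'v) module"
  assumes V: "vectorspace base_field V" and L: "finite L"
    and linL: "\<And>f. f \<in> L \<Longrightarrow> linear_functional V f"
    and inj: "\<And>v. v \<in> carrier V \<Longrightarrow> (\<And>f. f \<in> L \<Longrightarrow> f v = 0) \<Longrightarrow> v = \<zero>\<^bsub>V\<^esub>"
  shows "vectorspace.fin_dim base_field V" "vectorspace.dim base_field V \<le> card L"
proof -
  interpret vectorspace base_field V by fact
  have fin: "card A \<le> card L" if A: "finite A" "A \<subseteq> carrier V" "lin_indpt A" for A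
  proof (rule ccontr)
    assume "\<not> card A \<le> card L"
    moreover obtain J s where J: "J \<subseteq> A" "card A \<le> card J + card L"
      and s: "independent_solutions (\<lambda>f v. f v) A L J s"
      using homogeneous_system_solutions[OF A(1) L, of "\<lambda>f v. f v"] by blast
    ultimately have "card J > 0" by simp
    then obtain j where j: "j \<in> J" by fastforce
    have fJ: "finite J" using J(1) A(1) by (rule finite_subset)
    have "\<exists>u\<in>A. s j u \<noteq> 0"
    proof (rule ccontr)
      assume "\<not> ?thesis"
      moreover have "(\<Sum>i\<in>J. of_bool (i = j) * s i u) = s j u" for u
        using fJ j by (intro sum_of_bool_eq_mult) auto
      ultimately have zero: "\<forall>u\<in>A. (\<Sum>i\<in>J. of_bool (i = j) * s i u) = 0" by simp
      have "\<forall>i\<in>J. c i = 0" if "\<forall>u\<in>A. (\<Sum>i\<in>J. c i * s i u) = 0" for c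
        using s that by (simp add: independent_solutions_def)
      from this[OF zero] have "\<forall>i\<in>J. of_bool (i = j) = (0::'k)" .
      then have "of_bool (j = j) = (0::'k)" using j by blast
      then show False by simp
    qed
    then obtain u where u: "u \<in> A" "s j u \<noteq> 0" by blast
    have "f (lincomb (s j) A) = 0" if "f \<in> L" for f
      using s j that A unfolding independent_solutions_def
      by (subst functional_lincomb[OF V linL[OF that]]) (auto simp: mult.commute)
    then have "lincomb (s j) A = \<zero>\<^bsub>V\<^esub>"
      using A by (intro inj lincomb_closed) (auto simp: base_field_simps)
    then have "lin_dep A"
      using u A by (intro lin_dep_crit[of A A "s j" u]) (auto simp: base_field_simps)
    with A show False by simp
  qed
  have "finite A \<and> card A \<le> card L" if A: "A \<subseteq> carrier V \<and> lin_indpt A" for A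
  proof -
    have "finite A"
    proof (rule ccontr)
      assume "infinite A"
      then obtain B where B: "B \<subseteq> A" "finite B" "card B = Suc (card L)"
        using infinite_arbitrarily_large by blast
      then have "lin_indpt B" using A unfolding lin_dep_def by blast
      with fin[of B] B A show False by auto
    qed
    with fin A show ?thesis by blast
  qed
  moreover have "{} \<subseteq> carrier V \<and> lin_indpt {}" by (auto simp: lin_dep_def)
  ultimately obtain B where B: "finite B" "maximal B (\<lambda>A. A \<subseteq> carrier V \<and> lin_indpt A)"
    using maximal_exists[of "\<lambda>A. A \<subseteq> carrier V \<and> lin_indpt A" "card L" "{}"] by metis
  then have basis: "basis B" by (intro max_li_is_basis)
  with B show "fin_dim" unfolding fin_dim_def basis_def by blast
  have "card B \<le> card L" using B basis by (intro fin) (auto simp: basis_def)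
  with dim_basis[OF B(1) basis] show "dim \<le> card L" by simp
qed

section \<open>Monomial ideals\<close>

lemma exhaust_three:
  fixes i :: 3
  shows "i = 1 \<or> i = 2 \<or> i = 3"
proof (induct i)
  case (of_int z)
  then have "z = 0 \<or> z = 1 \<or> z = 2" by fastforce
  then show ?case by auto
qed

lemma all_three: "(\<forall>i::3. P i) \<longleftrightarrow> P 1 \<and> P 2 \<and> P 3"
  by (metis exhaust_three)

definition vec3 :: "'a \<Rightarrow> 'a \<Rightarrow> 'a \<Rightarrow> 'a ^ 3" where
  "vec3 x y z = (\<chi> i. if i = 1 then x else if i = 2 then y else z)"

lemma vec3_nth [simp]: "vec3 x y z $ 1 = x" "vec3 x y z $ 2 = y" "vec3 x y z $ 3 = z"
  by (simp_all add: vec3_def)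

lemma vec3_eq_iff: "a = b \<longleftrightarrow> a $ 1 = b $ 1 \<and> a $ 2 = b $ 2 \<and> a $ 3 = b $ (3::3)"
  by (simp add: vec_eq_iff all_three)

lemma vec3_le_iff:
  fixes a b :: "nat ^ 3"
  shows "a \<le> b \<longleftrightarrow> a $ 1 \<le> b $ 1 \<and> a $ 2 \<le> b $ 2 \<and> a $ 3 \<le> b $ 3"
  by (simp add: less_eq_vec_def all_three)

lemma poly3_ring_simps:
  "carrier poly3_ring = UNIV" "\<zero>\<^bsub>poly3_ring\<^esub> = 0" "\<one>\<^bsub>poly3_ring\<^esub> = 1"
  "f \<oplus>\<^bsub>poly3_ring\<^esub> g = f + g" "f \<otimes>\<^bsub>poly3_ring\<^esub> g = f * g"
  by (simp_all add: ring_of_type_algebra_def)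

lemma poly_mapping_sum_single:
  fixes f :: "'a \<Rightarrow>\<^sub>0 'b::comm_monoid_add"
  shows "(\<Sum>k\<in>Poly_Mapping.keys f. Poly_Mapping.single k (Poly_Mapping.lookup f k)) = f"
proof (rule poly_mapping_eqI)
  fix k
  have "Poly_Mapping.lookup (\<Sum>k\<in>Poly_Mapping.keys f. Poly_Mapping.single k (Poly_Mapping.lookup f k)) k =
      (\<Sum>l\<in>Poly_Mapping.keys f. if l = k then Poly_Mapping.lookup f l else 0)"
    by (simp add: lookup_sum lookup_single when_def)
  also have "\<dots> = Poly_Mapping.lookup f k"
    by (simp add: in_keys_iff)
  finally show "Poly_Mapping.lookup (\<Sum>k\<in>Poly_Mapping.keys f. Poly_Mapping.single k (Poly_Mapping.lookup f k)) k
    = Poly_Mapping.lookup f k" .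
qed

text \<open>Confining the keys to \<open>E\<close> allows induction inside a monomial ideal, with
  single terms of the ideal as base cases.\<close>

lemma poly_mapping_single_induct:
  fixes f :: "'a \<Rightarrow>\<^sub>0 'b::comm_monoid_add"
  assumes "Poly_Mapping.keys f \<subseteq> E" "P 0"
    and add: "\<And>f g. Poly_Mapping.keys f \<subseteq> E \<Longrightarrow> Poly_Mapping.keys g \<subseteq> E \<Longrightarrow> P f \<Longrightarrow> P g \<Longrightarrow> P (f + g)"
    and single: "\<And>k c. k \<in> E \<Longrightarrow> P (Poly_Mapping.single k c)"
  shows "P f"
proof -
  have "Poly_Mapping.keys (\<Sum>k\<in>K. Poly_Mapping.single k (Poly_Mapping.lookup f k)) \<subseteq> E \<and>
      P (\<Sum>k\<in>K. Poly_Mapping.single k (Poly_Mapping.lookup f k))"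
    if "finite K" "K \<subseteq> E" for K
    using that
  proof induction
    case (insert k K)
    have "Poly_Mapping.keys (Poly_Mapping.single k (Poly_Mapping.lookup f k)) \<subseteq> E"
      using insert by auto
    with insert add[OF this] single[of k]
      keys_add[of "Poly_Mapping.single k (Poly_Mapping.lookup f k)"
        "\<Sum>k\<in>K. Poly_Mapping.single k (Poly_Mapping.lookup f k)"]
    show ?case by auto
  qed (use assms(2) in auto)
  from this[of "Poly_Mapping.keys f"] assms(1) show ?thesis by (simp add: poly_mapping_sum_single)
qed

text \<open>The polynomials supported on the upward closure \<open>E\<close> of the generators form
  an ideal containing the generators, hence containing \<open>I\<close>. Conversely, each term over
  \<open>E\<close> is a multiple of a generator.\<close>

lemma monomial_ideal_props:
  fixes I :: "'k::field poly3 set"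
  assumes "monomial_ideal I"
  shows "ideal I poly3_ring" "I = {f. \<forall>m. monom3 m \<notin> I \<longrightarrow> Poly_Mapping.lookup f m = 0}"
    "\<And>a b. monom3 a \<in> I \<Longrightarrow> a \<le> b \<Longrightarrow> monom3 b \<in> I"
proof -
  obtain A where I: "I = genideal poly3_ring (monom3 ` A)" using assms by (auto simp: monomial_ideal_def)
  interpret R: cring "poly3_ring :: 'k poly3 ring" by (rule cring_from_type_algebra)
  show id: "ideal I poly3_ring" unfolding I
    by (rule R.genideal_ideal) (simp add: poly3_ring_simps)
  then interpret I: ideal I "poly3_ring :: 'k poly3 ring" .
  have add: "f + g \<in> I" if "f \<in> I" "g \<in> I" for f g
    using I.a_closed[OF that] by (simp add: poly3_ring_simps)
  have mult: "r * f \<in> I" if "f \<in> I" for f r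
    using I.I_l_closed[OF that, of r] by (simp add: poly3_ring_simps)
  have zero: "0 \<in> I" using I.zero_closed by (simp add: poly3_ring_simps)
  have single: "Poly_Mapping.single b c \<in> I" if "monom3 a \<in> I" "a \<le> b" for a b c
  proof -
    have "b - a + a = b" using that(2) by (simp add: vec3_eq_iff vec3_le_iff)
    then have "Poly_Mapping.single b c = Poly_Mapping.single (b - a) c * (monom3 a :: 'k poly3)"
      by (simp add: monom3_def mult_single)
    with mult that show ?thesis by simp
  qed
  show up: "monom3 b \<in> I" if "monom3 a \<in> I" "a \<le> b" for a b
    using single[OF that, of 1] by (simp add: monom3_def)
  define E where "E = {b. \<exists>a\<in>A. a \<le> b}"
  define I' where "I' = {f :: 'k poly3. Poly_Mapping.keys f \<subseteq> E}"
  have A: "monom3 a \<in> I" if "a \<in> A" for a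
    using that R.genideal_self[of "monom3 ` A"] by (auto simp: I poly3_ring_simps)
  have "ideal I' poly3_ring"
  proof (rule idealI)
    show "Ring.ring (poly3_ring :: 'k poly3 ring)" by (rule R.ring_axioms)
    show "subgroup I' (add_monoid poly3_ring)"
    proof (rule R.add.subgroupI)
      show "I' \<subseteq> carrier poly3_ring" by (simp add: poly3_ring_simps)
      show "I' \<noteq> {}" by (auto simp: I'_def intro!: exI[of _ 0])
      fix f g assume f: "f \<in> I'" 
      have "\<ominus>\<^bsub>poly3_ring\<^esub> f = - f"
        by (rule R.minus_equality) (simp_all add: poly3_ring_simps)
      with f show "\<ominus>\<^bsub>poly3_ring\<^esub> f \<in> I'"
        by (simp add: I'_def in_keys_iff subset_iff)
      assume "g \<in> I'"
      with f show "f \<oplus>\<^bsub>poly3_ring\<^esub> g \<in> I'"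
        using keys_add[of f g] by (auto simp: I'_def poly3_ring_simps)
    qed
    fix f r assume f: "f \<in> I'"
    have "Poly_Mapping.keys (r * f) \<subseteq> E"
    proof
      fix b assume "b \<in> Poly_Mapping.keys (r * f)"
      then obtain d a where "b = d + a" "a \<in> Poly_Mapping.keys f" using keys_mult[of r f] by auto
      moreover from this f obtain a0 where "a0 \<in> A" "a0 \<le> a" by (auto simp: I'_def E_def)
      moreover from this have "a0 \<le> d + a" by (simp add: vec3_le_iff trans_le_add2)
      ultimately show "b \<in> E" by (auto simp: E_def)
    qed
    then show "r \<otimes>\<^bsub>poly3_ring\<^esub> f \<in> I'" "f \<otimes>\<^bsub>poly3_ring\<^esub> r \<in> I'"
      by (simp_all add: I'_def poly3_ring_simps mult.commute)
  qed
  moreover have "monom3 ` A \<subseteq> I'" by (auto simp: I'_def E_def monom3_def)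
  ultimately have "I \<subseteq> I'" unfolding I by (intro R.genideal_minimal)
  have mE: "monom3 a \<in> I \<longleftrightarrow> a \<in> E" for a
  proof
    assume "monom3 a \<in> I"
    with \<open>I \<subseteq> I'\<close> show "a \<in> E" by (auto simp: I'_def monom3_def)
  next
    assume "a \<in> E"
    then show "monom3 a \<in> I" using A up by (auto simp: E_def)
  qed
  have "I' \<subseteq> I"
  proof
    fix f assume "f \<in> I'"
    then have "Poly_Mapping.keys f \<subseteq> E" by (simp add: I'_def)
    then show "f \<in> I"
      by (rule poly_mapping_single_induct) (use zero add single mE order_refl in blast)+
  qed
  with \<open>I \<subseteq> I'\<close> have "I = I'" by blast
  then show "I = {f. \<forall>m. monom3 m \<notin> I \<longrightarrow> Poly_Mapping.lookup f m = 0}"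
    unfolding mE by (auto simp: I'_def in_keys_iff)
qed

lemma lookup_const_poly_mult:
  "Poly_Mapping.lookup (const_poly c * f) m = c * Poly_Mapping.lookup f m"
  unfolding const_poly_def
  by (subst mult_map_scale_conv_mult[symmetric]) (simp add: Poly_Mapping.map.rep_eq when_def)

locale cofinite_monomial_ideal =
  fixes I :: "'k::field poly3 set"
  assumes monomial: "monomial_ideal I" and cofinite: "cofinite_ideal I"
begin

definition standard_monomials :: "(nat ^ 3) set" where
  "standard_monomials = {m. monom3 m \<notin> I}"

definition coset :: "'k poly3 \<Rightarrow> 'k poly3 set" where
  "coset f = I +>\<^bsub>poly3_ring\<^esub> f"

text \<open>On a coset the value is independent of the chosen representative when \<open>m\<close>
  is a standard monomial.\<close>

definition coset_coeff :: "nat ^ 3 \<Rightarrow> 'k poly3 set \<Rightarrow> 'k" where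
  "coset_coeff m C = Poly_Mapping.lookup (SOME f. f \<in> C) m"

lemma ideal_I: "ideal I poly3_ring"
  by (rule monomial_ideal_props(1)[OF monomial])

lemma mem_I_iff: "f \<in> I \<longleftrightarrow> (\<forall>m\<in>standard_monomials. Poly_Mapping.lookup f m = 0)"
  using monomial_ideal_props(2)[OF monomial] by (auto simp: standard_monomials_def)

lemma monom3_mem_I_iff: "monom3 m \<in> I \<longleftrightarrow> m \<notin> standard_monomials"
  by (simp add: standard_monomials_def)

lemma monom3_up: "monom3 a \<in> I \<Longrightarrow> a \<le> b \<Longrightarrow> monom3 b \<in> I"
  by (rule monomial_ideal_props(3)[OF monomial])

lemma standard_monomials_down: "b \<in> standard_monomials \<Longrightarrow> a \<le> b \<Longrightarrow> a \<in> standard_monomials"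
  using monom3_up by (auto simp: standard_monomials_def)

lemma mem_coset_iff:
  "g \<in> coset f \<longleftrightarrow> (\<forall>m\<in>standard_monomials. Poly_Mapping.lookup g m = Poly_Mapping.lookup f m)"
proof -
  have "g \<in> coset f \<longleftrightarrow> g - f \<in> I"
    by (force simp: coset_def a_r_coset_def' poly3_ring_simps intro: exI[of _ "g - f"])
  then show ?thesis by (simp add: mem_I_iff lookup_minus)
qed

lemma coset_eq_iff:
  "coset f = coset g \<longleftrightarrow> (\<forall>m\<in>standard_monomials. Poly_Mapping.lookup f m = Poly_Mapping.lookup g m)"
proof
  assume "coset f = coset g"
  moreover have "f \<in> coset f" by (simp add: mem_coset_iff)
  ultimately show "\<forall>m\<in>standard_monomials. Poly_Mapping.lookup f m = Poly_Mapping.lookup g m"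
    by (simp add: mem_coset_iff)
qed (auto simp: mem_coset_iff)

lemma coset_coeff_coset [simp]:
  assumes "m \<in> standard_monomials"
  shows "coset_coeff m (coset f) = Poly_Mapping.lookup f m"
proof -
  have "(SOME g. g \<in> coset f) \<in> coset f"
    by (rule someI[of _ f]) (simp add: mem_coset_iff)
  with assms show ?thesis by (simp add: mem_coset_iff coset_coeff_def)
qed

abbreviation "QM \<equiv> quotient_module poly3_ring I"

lemma QM_simps:
  "carrier QM = range coset" "\<zero>\<^bsub>QM\<^esub> = coset 0"
  "coset f \<oplus>\<^bsub>QM\<^esub> coset g = coset (f + g)" "r \<odot>\<^bsub>QM\<^esub> coset f = coset (r * f)"
proof -
  interpret I: ideal I "poly3_ring :: 'k poly3 ring" by (rule ideal_I)
  show "carrier QM = range coset"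
    by (auto simp: quotient_module_def FactRing_def A_RCOSETS_def' coset_def poly3_ring_simps)
  have "coset 0 = I" by (auto simp: mem_coset_iff mem_I_iff)
  then show "\<zero>\<^bsub>QM\<^esub> = coset 0" by (simp add: quotient_module_def FactRing_def)
  show "coset f \<oplus>\<^bsub>QM\<^esub> coset g = coset (f + g)"
    using I.a_rcos_sum[of f g]
    by (simp add: quotient_module_def FactRing_def coset_def poly3_ring_simps)
  show "r \<odot>\<^bsub>QM\<^esub> coset f = coset (r * f)"
    using I.rcoset_mult_add[of r f]
    by (simp add: quotient_module_def FactRing_def coset_def poly3_ring_simps)
qed

lemma vectorspace_Q: "vectorspace base_field (quotient_space I)"
  by (rule vectorspace_quotient_space[OF ideal_I])

lemma vectorspace_T: "vectorspace base_field (tangent_space I)"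
  by (rule vectorspace_tangent_space[OF ideal_I])

lemma Q_simps:
  "carrier (quotient_space I) = range coset" "\<zero>\<^bsub>quotient_space I\<^esub> = coset 0"
  "coset f \<oplus>\<^bsub>quotient_space I\<^esub> coset g = coset (f + g)"
  "c \<odot>\<^bsub>quotient_space I\<^esub> coset f = coset (const_poly c * f)"
  by (simp_all add: quotient_space_def restrict_scalars_def QM_simps)

lemma linear_functional_Q:
  assumes "m \<in> standard_monomials"
  shows "linear_functional (quotient_space I) (coset_coeff m)"
  using assms
  by (auto simp: linear_functional_def Q_simps lookup_add lookup_const_poly_mult)

text \<open>The coefficient functionals separate the cosets of standard monomials, so the dimension
  bounds the size of every finite set of them.\<close>

lemma finite_standard_monomials: "finite standard_monomials"
proof (rule ccontr)
  assume "infinite standard_monomials"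
  then obtain F where F: "F \<subseteq> standard_monomials" "finite F"
    "card F = Suc (vectorspace.dim base_field (quotient_space I))"
    using infinite_arbitrarily_large by blast
  have "card F \<le> vectorspace.dim base_field (quotient_space I)"
  proof (rule card_le_dim_of_functionals[OF vectorspace_Q _ F(2)])
    show "vectorspace.fin_dim base_field (quotient_space I)"
      using cofinite by (simp add: cofinite_ideal_def)
    show "coset (monom3 m) \<in> carrier (quotient_space I)" if "m \<in> F" for m
      by (simp add: Q_simps)
    show "linear_functional (quotient_space I) f" if "f \<in> coset_coeff ` F" for f
      using that F linear_functional_Q by auto
  next
    fix c j assume c: "\<And>f. f \<in> coset_coeff ` F \<Longrightarrow> (\<Sum>m\<in>F. c m * f (coset (monom3 m))) = 0" and j: "j \<in> F"
    have "0 = (\<Sum>m\<in>F. c m * coset_coeff j (coset (monom3 m)))" using c j by auto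
    also have "\<dots> = (\<Sum>m\<in>F. of_bool (m = j) * c m)"
      using j F by (intro sum.cong) (auto simp: monom3_def lookup_single)
    also have "\<dots> = c j" using F j by (intro sum_of_bool_eq_mult) auto
    finally show "c j = 0" by simp
  qed
  with F show False by simp
qed

lemma dim_quotient_space_le:
  "vectorspace.dim base_field (quotient_space I) \<le> card standard_monomials"
proof -
  have "vectorspace.dim base_field (quotient_space I) \<le> card (coset_coeff ` standard_monomials)"
  proof (rule dim_le_card_functionals(2)[OF vectorspace_Q])
    fix v assume "v \<in> carrier (quotient_space I)"
      and zero: "\<And>f. f \<in> coset_coeff ` standard_monomials \<Longrightarrow> f v = 0"
    then obtain f where f: "v = coset f" by (auto simp: Q_simps)
    have "Poly_Mapping.lookup f m = 0" if "m \<in> standard_monomials" for m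
      using zero[of "coset_coeff m"] that by (simp add: f)
    then show "v = \<zero>\<^bsub>quotient_space I\<^esub>" by (simp add: f Q_simps(2) coset_eq_iff)
  qed (auto simp: finite_standard_monomials linear_functional_Q)
  also have "\<dots> \<le> card standard_monomials"
    by (rule card_image_le[OF finite_standard_monomials])
  finally show ?thesis .
qed

section \<open>The tangent space and its coefficient functionals\<close>

lemma tangent_carrier_iff:
  "\<phi> \<in> carrier (tangent_space I) \<longleftrightarrow> \<phi> \<in> extensional I \<and> (\<forall>f\<in>I. \<phi> f \<in> range coset) \<and>
    (\<forall>f\<in>I. \<forall>g\<in>I. \<phi> (f + g) = \<phi> f \<oplus>\<^bsub>QM\<^esub> \<phi> g) \<and> (\<forall>r. \<forall>f\<in>I. \<phi> (r * f) = r \<odot>\<^bsub>QM\<^esub> \<phi> f)"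
  by (auto simp: tangent_space_def restrict_scalars_def Hom_module_def module_hom_def
      ideal_module_def QM_simps poly3_ring_simps)

lemma T_simps:
  "f \<in> I \<Longrightarrow> (\<phi> \<oplus>\<^bsub>tangent_space I\<^esub> \<psi>) f = \<phi> f \<oplus>\<^bsub>QM\<^esub> \<psi> f"
  "f \<in> I \<Longrightarrow> (c \<odot>\<^bsub>tangent_space I\<^esub> \<phi>) f = const_poly c \<odot>\<^bsub>QM\<^esub> \<phi> f"
  "\<zero>\<^bsub>tangent_space I\<^esub> = (\<lambda>f\<in>I. coset 0)"
  by (simp_all add: tangent_space_def restrict_scalars_def Hom_module_def ideal_module_def QM_simps)

definition tangent_coeff :: "nat ^ 3 \<Rightarrow> nat ^ 3 \<Rightarrow> ('k poly3 \<Rightarrow> 'k poly3 set) \<Rightarrow> 'k" where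
  "tangent_coeff w m \<phi> = coset_coeff m (\<phi> (monom3 w))"

lemma linear_functional_T:
  assumes m: "m \<in> standard_monomials" and w: "monom3 w \<in> I"
  shows "linear_functional (tangent_space I) (tangent_coeff w m)"
  unfolding linear_functional_def
proof (intro conjI ballI allI)
  fix \<phi> assume \<phi>: "\<phi> \<in> carrier (tangent_space I)"
  then obtain f where f: "\<phi> (monom3 w) = coset f" using w by (auto simp: tangent_carrier_iff)
  show "tangent_coeff w m (c \<odot>\<^bsub>tangent_space I\<^esub> \<phi>) = c * tangent_coeff w m \<phi>" for c
    using m w by (simp add: tangent_coeff_def T_simps f QM_simps lookup_const_poly_mult)
  fix \<psi> assume "\<psi> \<in> carrier (tangent_space I)"
  then obtain g where g: "\<psi> (monom3 w) = coset g" using w by (auto simp: tangent_carrier_iff)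
  show "tangent_coeff w m (\<phi> \<oplus>\<^bsub>tangent_space I\<^esub> \<psi>) = tangent_coeff w m \<phi> + tangent_coeff w m \<psi>"
    using m w by (simp add: tangent_coeff_def T_simps f g QM_simps lookup_add)
qed

lemma ex_bound: "\<exists>M::nat. \<forall>m\<in>standard_monomials. \<forall>i. m $ i < M"
proof -
  have "finite (\<Union>m\<in>standard_monomials. {m $ 1, m $ 2, m $ 3})"
    using finite_standard_monomials by auto
  then obtain M where "\<forall>k\<in>(\<Union>m\<in>standard_monomials. {m $ 1, m $ 2, m $ 3}). k < M"
    using finite_nat_set_iff_bounded by blast
  then show ?thesis by (intro exI[of _ M]) (auto simp: all_three)
qed

text \<open>A homomorphism is determined by finitely many coefficients: those at standard monomials
  of its values on the monomials of \<open>I\<close> with exponents at most \<open>M\<close>, which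
  generate \<open>I\<close>.\<close>

lemma fin_dim_tangent_space: "vectorspace.fin_dim base_field (tangent_space I)"
proof -
  obtain M where M: "\<And>m i. m \<in> standard_monomials \<Longrightarrow> m $ i < M"
    using ex_bound by blast
  define G where "G = {w :: nat ^ 3. monom3 w \<in> I \<and> w $ 1 \<le> M \<and> w $ 2 \<le> M \<and> w $ 3 \<le> M}"
  have "G \<subseteq> (\<lambda>(x, y, z). vec3 x y z) ` ({..M} \<times> {..M} \<times> {..M})"
  proof
    fix w assume "w \<in> G"
    then show "w \<in> (\<lambda>(x, y, z). vec3 x y z) ` ({..M} \<times> {..M} \<times> {..M})"
      by (intro image_eqI[of _ _ "(w $ 1, w $ 2, w $ 3)"]) (auto simp: G_def vec3_eq_iff)
  qed
  then have finG: "finite G" by (rule finite_subset) simp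
  define L where "L = (\<lambda>(w, m). tangent_coeff w m) ` (G \<times> standard_monomials)"
  show ?thesis
  proof (rule dim_le_card_functionals(1)[OF vectorspace_T, of L])
    show "finite L" using finG finite_standard_monomials by (simp add: L_def)
    show "linear_functional (tangent_space I) f" if "f \<in> L" for f
      using that linear_functional_T by (auto simp: L_def G_def)
  next
    fix \<phi> assume \<phi>: "\<phi> \<in> carrier (tangent_space I)" and zero: "\<And>f. f \<in> L \<Longrightarrow> f \<phi> = 0"
    have G0: "\<phi> (monom3 w) = coset 0" if "w \<in> G" for w
    proof -
      have "monom3 w \<in> I" using that by (simp add: G_def)
      then obtain f where f: "\<phi> (monom3 w) = coset f" using \<phi> by (auto simp: tangent_carrier_iff)
      have "Poly_Mapping.lookup f m = 0" if "m \<in> standard_monomials" for m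
      proof -
        have "tangent_coeff w m \<in> L" using \<open>w \<in> G\<close> that by (auto simp: L_def)
        from zero[OF this] that show ?thesis by (simp add: tangent_coeff_def f)
      qed
      then show ?thesis by (simp add: f coset_eq_iff)
    qed
    have single0: "\<phi> (Poly_Mapping.single w c) = coset 0" if w: "monom3 w \<in> I" for w c
    proof -
      \<comment> \<open>Cutting exponents down to \<open>M\<close> does not leave \<open>I\<close>:
        if anything is cut, \<open>v\<close> has an exponent \<open>M\<close>, which no standard
        monomial has.\<close>
      define v :: "nat ^ 3" where "v = vec3 (min (w $ 1) M) (min (w $ 2) M) (min (w $ 3) M)"
      have "v \<le> w" by (simp add: v_def vec3_le_iff)
      have "monom3 v \<in> I"
      proof (cases "v = w")
        case False
        then have "v $ 1 = M \<or> v $ 2 = M \<or> v $ 3 = M" by (auto simp: v_def vec3_eq_iff)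
        then show ?thesis using M[of v 1] M[of v 2] M[of v 3] by (auto simp: monom3_mem_I_iff)
      qed (use w in simp)
      then have "v \<in> G" by (simp add: G_def v_def)
      have "w - v + v = w" using \<open>v \<le> w\<close> by (simp add: vec3_eq_iff vec3_le_iff)
      then have "Poly_Mapping.single w c = Poly_Mapping.single (w - v) c * (monom3 v :: 'k poly3)"
        by (simp add: monom3_def mult_single)
      then show ?thesis
        using \<phi> \<open>monom3 v \<in> I\<close> G0[OF \<open>v \<in> G\<close>] by (simp add: tangent_carrier_iff QM_simps)
    qed
    have "f \<in> I \<and> \<phi> f = coset 0" if "f \<in> I" for f
    proof (rule poly_mapping_single_induct[of f "{w. monom3 w \<in> I}" "\<lambda>f. f \<in> I \<and> \<phi> f = coset 0"])
      show "Poly_Mapping.keys f \<subseteq> {w. monom3 w \<in> I}"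
        using that by (auto simp: mem_I_iff[of f] monom3_mem_I_iff in_keys_iff)
      have "\<phi> (0 * f) = 0 \<odot>\<^bsub>QM\<^esub> \<phi> f" using \<phi> that unfolding tangent_carrier_iff by blast
      moreover have "\<phi> f \<in> range coset" using \<phi> that unfolding tangent_carrier_iff by blast
      then obtain g where "\<phi> f = coset g" by blast
      ultimately show "0 \<in> I \<and> \<phi> 0 = coset 0" by (simp add: QM_simps mem_I_iff)
    next
      fix f g assume "f \<in> I \<and> \<phi> f = coset 0" "g \<in> I \<and> \<phi> g = coset 0"
      then show "f + g \<in> I \<and> \<phi> (f + g) = coset 0"
        using \<phi> by (simp add: tangent_carrier_iff QM_simps) (simp add: mem_I_iff lookup_add)
    next
      fix w and c :: 'k assume w: "w \<in> {w. monom3 w \<in> I}"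
      then have "Poly_Mapping.single w c \<in> I"
        by (auto simp: mem_I_iff[of "Poly_Mapping.single w c"] monom3_mem_I_iff lookup_single when_def)
      with single0 w show "Poly_Mapping.single w c \<in> I \<and> \<phi> (Poly_Mapping.single w c) = coset 0" by simp
    qed
    then have "\<phi> f = (\<lambda>f\<in>I. coset 0) f" for f
      using \<phi> by (auto simp: tangent_carrier_iff extensional_def)
    then show "\<phi> = \<zero>\<^bsub>tangent_space I\<^esub>" by (auto simp: T_simps)
  qed
qed

text \<open>Integer arguments let degrees with negative entries be added without truncation.\<close>

definition staircase_pred :: "int \<Rightarrow> int \<Rightarrow> int \<Rightarrow> bool" where
  "staircase_pred x y z \<longleftrightarrow> 0 \<le> x \<and> 0 \<le> y \<and> 0 \<le> z \<and> vec3 (nat x) (nat y) (nat z) \<in> standard_monomials"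

lemma ex_staircase: "\<exists>M. staircase staircase_pred M"
proof -
  obtain M where M: "\<And>m i. m \<in> standard_monomials \<Longrightarrow> m $ i < M"
    using ex_bound by blast
  have "staircase staircase_pred (int M)"
  proof
    fix x y z assume "staircase_pred x y z"
    then have *: "0 \<le> x" "0 \<le> y" "0 \<le> z" "vec3 (nat x) (nat y) (nat z) \<in> standard_monomials"
      by (auto simp: staircase_pred_def)
    then show "0 \<le> x \<and> 0 \<le> y \<and> 0 \<le> z" by simp
    show "x < int M \<and> y < int M \<and> z < int M"
      using M[OF *(4), of 1] M[OF *(4), of 2] M[OF *(4), of 3] * by auto
    fix x' y' z' assume "0 \<le> x'" "0 \<le> y'" "0 \<le> z'" "x' \<le> x" "y' \<le> y" "z' \<le> z"
    with * show "staircase_pred x' y' z'"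
      using standard_monomials_down[OF *(4), of "vec3 (nat x') (nat y') (nat z')"]
      by (auto simp: staircase_pred_def vec3_le_iff nat_mono)
  qed
  then show ?thesis ..
qed

lemma card_staircase_pred: "card {(x, y, z). staircase_pred x y z} = card standard_monomials"
  by (rule bij_betw_same_card[of "\<lambda>(x, y, z). vec3 (nat x) (nat y) (nat z)"],
      rule bij_betw_byWitness[of _ "\<lambda>m. (int (m $ 1), int (m $ 2), int (m $ 3))"])
    (auto simp: staircase_pred_def vec3_eq_iff intro: standard_monomials_down simp: vec3_le_iff)

lemma socle_point_of_socle_monomial:
  assumes "a \<in> socle_monomials I"
  shows "socle_point staircase_pred (int (a $ 1)) (int (a $ 2)) (int (a $ 3))"
  unfolding socle_point_def
proof (intro conjI allI impI; (elim conjE)?)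
  have a: "a \<in> standard_monomials" "\<And>b. b \<in> standard_monomials \<Longrightarrow> a \<le> b \<Longrightarrow> b = a"
    using assms by (auto simp: socle_monomials_def standard_monomials_def)
  have "vec3 (a $ 1) (a $ 2) (a $ 3) = a" by (simp add: vec3_eq_iff)
  with a(1) show "staircase_pred (int (a $ 1)) (int (a $ 2)) (int (a $ 3))"
    by (simp add: staircase_pred_def)
  fix x y z assume *: "staircase_pred x y z" "int (a $ 1) \<le> x" "int (a $ 2) \<le> y" "int (a $ 3) \<le> z"
  then have "vec3 (nat x) (nat y) (nat z) = a"
    by (intro a(2)) (auto simp: staircase_pred_def vec3_le_iff)
  with * show "x = int (a $ 1)" "y = int (a $ 2)" "z = int (a $ 3)"
    by (auto simp: vec3_eq_iff)
qed

section \<open>Tangent vectors from coefficients\<close>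

text \<open>
  The truncation by \<open>nat\<close> below is harmless: the coefficients \<open>\<phi>\<close> vanish at points with a negative
  coordinate, and \<open>target w\<close> is only used when \<open>weight \<phi> w \<noteq> 0\<close>.
\<close>

definition tangent_poly ::
  "int \<Rightarrow> int \<Rightarrow> int \<Rightarrow> (int \<Rightarrow> int \<Rightarrow> int \<Rightarrow> 'k) \<Rightarrow> 'k poly3 \<Rightarrow> 'k poly3" where
  "tangent_poly a1 a2 a3 \<phi> f = Abs_poly_mapping (\<lambda>m. if m \<in> standard_monomials
    then Poly_Mapping.lookup f
        (vec3 (nat (int (m $ 1) - a1)) (nat (int (m $ 2) - a2)) (nat (int (m $ 3) - a3)))
      * \<phi> (int (m $ 1) - a1) (int (m $ 2) - a2) (int (m $ 3) - a3)
    else 0)"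

definition tangent_vector ::
  "int \<Rightarrow> int \<Rightarrow> int \<Rightarrow> (int \<Rightarrow> int \<Rightarrow> int \<Rightarrow> 'k) \<Rightarrow> 'k poly3 \<Rightarrow> 'k poly3 set" where
  "tangent_vector a1 a2 a3 \<phi> = (\<lambda>f\<in>I. coset (tangent_poly a1 a2 a3 \<phi> f))"

lemma lookup_tangent_poly:
  "Poly_Mapping.lookup (tangent_poly a1 a2 a3 \<phi> f) m = (if m \<in> standard_monomials
    then Poly_Mapping.lookup f
        (vec3 (nat (int (m $ 1) - a1)) (nat (int (m $ 2) - a2)) (nat (int (m $ 3) - a3)))
      * \<phi> (int (m $ 1) - a1) (int (m $ 2) - a2) (int (m $ 3) - a3)
    else 0)"
  unfolding tangent_poly_def
  by (subst lookup_Abs_poly_mapping)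
    (rule finite_subset[OF _ finite_standard_monomials], auto)

lemma tangent_poly_add:
  "tangent_poly a1 a2 a3 \<phi> (f + g) = tangent_poly a1 a2 a3 \<phi> f + tangent_poly a1 a2 a3 \<phi> g"
  by (rule poly_mapping_eqI) (simp add: lookup_tangent_poly lookup_add algebra_simps)

lemma tangent_poly_zero: "tangent_poly a1 a2 a3 \<phi> 0 = 0"
  by (rule poly_mapping_eqI) (simp add: lookup_tangent_poly)

definition target :: "int \<Rightarrow> int \<Rightarrow> int \<Rightarrow> nat ^ 3 \<Rightarrow> nat ^ 3" where
  "target a1 a2 a3 w =
    vec3 (nat (int (w $ 1) + a1)) (nat (int (w $ 2) + a2)) (nat (int (w $ 3) + a3))"

definition weight :: "(int \<Rightarrow> int \<Rightarrow> int \<Rightarrow> 'k) \<Rightarrow> nat ^ 3 \<Rightarrow> 'k" where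
  "weight \<phi> w = \<phi> (int (w $ 1)) (int (w $ 2)) (int (w $ 3))"

context
  fixes a1 a2 a3 :: int and \<phi> :: "int \<Rightarrow> int \<Rightarrow> int \<Rightarrow> 'k"
  assumes hom: "hom_coeffs staircase_pred a1 a2 a3 \<phi>"
begin

lemma weight_nonzeroD:
  assumes "weight \<phi> w \<noteq> 0"
  shows "monom3 w \<in> I" "target a1 a2 a3 w \<in> standard_monomials"
    "0 \<le> int (w $ 1) + a1" "0 \<le> int (w $ 2) + a2" "0 \<le> int (w $ 3) + a3"
proof -
  note * = hom_coeffs_nonzeroD[OF hom assms[unfolded weight_def]]
  have "vec3 (w $ 1) (w $ 2) (w $ 3) = w" by (simp add: vec3_eq_iff)
  then show "monom3 w \<in> I" using *(4) by (simp add: staircase_pred_def monom3_mem_I_iff)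
  show "target a1 a2 a3 w \<in> standard_monomials"
    "0 \<le> int (w $ 1) + a1" "0 \<le> int (w $ 2) + a2" "0 \<le> int (w $ 3) + a3"
    using *(5) by (auto simp: staircase_pred_def target_def)
qed

text \<open>The truncation by \<open>nat\<close> could identify \<open>w\<close> with a wrong source
  only at points with a negative coordinate, and there \<open>\<phi>\<close> is 0.\<close>

lemma tangent_poly_single:
  "tangent_poly a1 a2 a3 \<phi> (Poly_Mapping.single w c) = Poly_Mapping.single (target a1 a2 a3 w) (c * weight \<phi> w)"
proof (rule poly_mapping_eqI)
  fix m :: "nat ^ 3"
  define x y z where "x = int (m $ 1) - a1" and "y = int (m $ 2) - a2" and "z = int (m $ 3) - a3"
  have L: "Poly_Mapping.lookup (tangent_poly a1 a2 a3 \<phi> (Poly_Mapping.single w c)) m =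
      (if m \<in> standard_monomials \<and> w = vec3 (nat x) (nat y) (nat z) then c * \<phi> x y z else 0)"
    by (simp add: lookup_tangent_poly lookup_single when_def x_def y_def z_def)
  show "Poly_Mapping.lookup (tangent_poly a1 a2 a3 \<phi> (Poly_Mapping.single w c)) m =
      Poly_Mapping.lookup (Poly_Mapping.single (target a1 a2 a3 w) (c * weight \<phi> w)) m"
  proof (cases "0 \<le> x \<and> 0 \<le> y \<and> 0 \<le> z \<and> w = vec3 (nat x) (nat y) (nat z)")
    case True
    then have w: "int (w $ 1) = x" "int (w $ 2) = y" "int (w $ 3) = z" by auto
    then have "target a1 a2 a3 w = m" by (auto simp: target_def x_def y_def z_def vec3_eq_iff)
    moreover have "weight \<phi> w = \<phi> x y z" by (simp add: weight_def w)
    ultimately show ?thesis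
      unfolding L using True weight_nonzeroD(2)[of w] by (auto simp: lookup_single when_def)
  next
    case False
    have "\<phi> x y z = 0 \<or> w \<noteq> vec3 (nat x) (nat y) (nat z)"
      using False hom_coeffs_nonzeroD[OF hom, of x y z] by auto
    moreover have "weight \<phi> w = 0 \<or> target a1 a2 a3 w \<noteq> m"
    proof (rule ccontr)
      assume "\<not> ?thesis"
      then have "weight \<phi> w \<noteq> 0" "target a1 a2 a3 w = m" by auto
      with weight_nonzeroD(3-5)[of w] have "int (w $ 1) = x" "int (w $ 2) = y" "int (w $ 3) = z"
        by (auto simp: target_def x_def y_def z_def)
      with False show False by (auto simp: vec3_eq_iff)
    qed
    ultimately show ?thesis unfolding L by (auto simp: lookup_single when_def)
  qed
qed

text \<open>Equality holds only modulo \<open>I\<close>, hence the restriction to standard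
  \<open>m\<close>: if \<open>w\<close> has nonzero weight and \<open>d + w\<close> has weight 0,
  then \<open>d + target a1 a2 a3 w\<close> is not standard.\<close>

lemma tangent_poly_mult_single:
  assumes w: "monom3 w \<in> I" and m: "m \<in> standard_monomials"
  shows "Poly_Mapping.lookup (tangent_poly a1 a2 a3 \<phi> (Poly_Mapping.single d b * Poly_Mapping.single w c)) m =
    Poly_Mapping.lookup (Poly_Mapping.single d b * tangent_poly a1 a2 a3 \<phi> (Poly_Mapping.single w c)) m"
proof -
  have tgt: "target a1 a2 a3 (d + w) = d + target a1 a2 a3 w" if "weight \<phi> w \<noteq> 0"
    using weight_nonzeroD[OF that] by (simp add: target_def vec3_eq_iff nat_add_distrib add.assoc)
  have "weight \<phi> (d + w) = 0 \<longrightarrow> weight \<phi> w = 0 \<or> d + target a1 a2 a3 w \<notin> standard_monomials"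
    and "weight \<phi> (d + w) \<noteq> 0 \<longrightarrow> weight \<phi> w = weight \<phi> (d + w)"
  proof -
    have eq: "weight \<phi> w = weight \<phi> (d + w)"
      if "staircase_pred (int ((d + w) $ 1) + a1) (int ((d + w) $ 2) + a2) (int ((d + w) $ 3) + a3)"
    proof -
      have "vec3 (w $ 1) (w $ 2) (w $ 3) = w" by (simp add: vec3_eq_iff)
      then have "\<not> staircase_pred (int (w $ 1)) (int (w $ 2)) (int (w $ 3))"
        using w by (simp add: staircase_pred_def monom3_mem_I_iff)
      then show ?thesis
        unfolding weight_def using that by (intro hom_coeffs_eqD[OF hom]) auto
    qed
    show "weight \<phi> (d + w) \<noteq> 0 \<longrightarrow> weight \<phi> w = weight \<phi> (d + w)"
      using eq hom_coeffs_nonzeroD(5)[OF hom] unfolding weight_def by blast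
    show "weight \<phi> (d + w) = 0 \<longrightarrow> weight \<phi> w = 0 \<or> d + target a1 a2 a3 w \<notin> standard_monomials"
    proof (intro impI, rule ccontr)
      assume "weight \<phi> (d + w) = 0" and n: "\<not> (weight \<phi> w = 0 \<or> d + target a1 a2 a3 w \<notin> standard_monomials)"
      moreover have "staircase_pred (int ((d + w) $ 1) + a1) (int ((d + w) $ 2) + a2) (int ((d + w) $ 3) + a3)"
        using n weight_nonzeroD[of w] tgt
        by (auto simp: staircase_pred_def target_def)
      ultimately show False using eq by simp
    qed
  qed
  then show ?thesis
    using m tgt
    by (cases "weight \<phi> (d + w) = 0"; cases "weight \<phi> w = 0")
      (auto simp: mult_single tangent_poly_single lookup_single when_def)
qed

lemma tangent_poly_mult:
  assumes f: "f \<in> I" and m: "m \<in> standard_monomials"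
  shows "Poly_Mapping.lookup (tangent_poly a1 a2 a3 \<phi> (r * f)) m =
    Poly_Mapping.lookup (r * tangent_poly a1 a2 a3 \<phi> f) m"
proof -
  have 1: "Poly_Mapping.lookup (tangent_poly a1 a2 a3 \<phi> (r * Poly_Mapping.single w c)) m =
      Poly_Mapping.lookup (r * tangent_poly a1 a2 a3 \<phi> (Poly_Mapping.single w c)) m"
    if "monom3 w \<in> I" for w c
    by (rule poly_mapping_single_induct[of r UNIV])
      (auto simp: tangent_poly_zero tangent_poly_add distrib_right lookup_add
        tangent_poly_mult_single[OF that m])
  show ?thesis
  proof (rule poly_mapping_single_induct[of f "{w. monom3 w \<in> I}"])
    show "Poly_Mapping.keys f \<subseteq> {w. monom3 w \<in> I}"
      using f by (auto simp: mem_I_iff[of f] monom3_mem_I_iff in_keys_iff)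
  qed (use 1 in \<open>auto simp: tangent_poly_zero tangent_poly_add distrib_left lookup_add\<close>)
qed

lemma tangent_vector_in_carrier: "tangent_vector a1 a2 a3 \<phi> \<in> carrier (tangent_space I)"
  unfolding tangent_carrier_iff
proof (intro conjI ballI allI)
  interpret I: ideal I "poly3_ring :: 'k poly3 ring" by (rule ideal_I)
  show "tangent_vector a1 a2 a3 \<phi> \<in> extensional I" by (simp add: tangent_vector_def)
  fix f assume f: "f \<in> I"
  then show "tangent_vector a1 a2 a3 \<phi> f \<in> range coset" by (simp add: tangent_vector_def)
  show "tangent_vector a1 a2 a3 \<phi> (r * f) = r \<odot>\<^bsub>QM\<^esub> tangent_vector a1 a2 a3 \<phi> f" for r
    using f I.I_l_closed[OF f, of r] tangent_poly_mult[OF f]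
    by (simp add: tangent_vector_def QM_simps poly3_ring_simps coset_eq_iff)
  fix g assume g: "g \<in> I"
  have "f + g \<in> I" using f g by (simp add: mem_I_iff lookup_add)
  show "tangent_vector a1 a2 a3 \<phi> (f + g) =
      tangent_vector a1 a2 a3 \<phi> f \<oplus>\<^bsub>QM\<^esub> tangent_vector a1 a2 a3 \<phi> g"
    using f g \<open>f + g \<in> I\<close>
    by (simp add: tangent_vector_def QM_simps poly3_ring_simps tangent_poly_add)
qed

lemma tangent_coeff_tangent_vector:
  assumes "monom3 w \<in> I" "m \<in> standard_monomials"
  shows "tangent_coeff w m (tangent_vector a1 a2 a3 \<phi>) = (if m = target a1 a2 a3 w then weight \<phi> w else 0)"
  using assms tangent_poly_single[of w 1]
  by (simp add: tangent_coeff_def tangent_vector_def) (simp add: monom3_def lookup_single when_def)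

lemma tangent_vector_in_degree_part:
  "tangent_vector a1 a2 a3 \<phi> \<in> tangent_degree_part I (vec3 a1 a2 a3)"
proof -
  have "tangent_poly a1 a2 a3 \<phi> f \<in> poly_degree_part (c + vec3 a1 a2 a3)"
    if f: "f \<in> poly_degree_part c" for f c
    unfolding poly_degree_part_def
  proof clarify
    fix m assume "m \<in> Poly_Mapping.keys (tangent_poly a1 a2 a3 \<phi> f)"
    then have nz: "Poly_Mapping.lookup f
        (vec3 (nat (int (m $ 1) - a1)) (nat (int (m $ 2) - a2)) (nat (int (m $ 3) - a3))) \<noteq> 0"
      "\<phi> (int (m $ 1) - a1) (int (m $ 2) - a2) (int (m $ 3) - a3) \<noteq> 0"
      by (auto simp: in_keys_iff lookup_tangent_poly split: if_splits)
    from f nz(1) have "(\<chi> i. int (vec3 (nat (int (m $ 1) - a1)) (nat (int (m $ 2) - a2))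
        (nat (int (m $ 3) - a3)) $ i)) = c"
      by (auto simp: poly_degree_part_def in_keys_iff)
    with hom_coeffs_nonzeroD(1-3)[OF hom nz(2)] show "(\<chi> i. int (m $ i)) = c + vec3 a1 a2 a3"
      by (auto simp: vec3_eq_iff)
  qed
  then show ?thesis
    unfolding tangent_degree_part_def quotient_degree_part_def
    using tangent_vector_in_carrier by (auto simp: tangent_vector_def coset_def)
qed

lemma tangent_signature_part_nonzero:
  assumes nz: "\<phi> x y z \<noteq> 0" and sig: "vec3 a1 a2 a3 \<in> orthant \<sigma>"
  shows "tangent_signature_part I \<sigma> \<noteq> {\<zero>\<^bsub>tangent_space I\<^esub>}"
proof -
  interpret T: vectorspace base_field "tangent_space I" by (rule vectorspace_T)
  define w where "w = vec3 (nat x) (nat y) (nat z)"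
  note * = hom_coeffs_nonzeroD[OF hom nz]
  have nz': "weight \<phi> w \<noteq> 0" using * nz by (simp add: weight_def w_def)
  note w = weight_nonzeroD[OF nz']
  have "tangent_vector a1 a2 a3 \<phi> \<noteq> \<zero>\<^bsub>tangent_space I\<^esub>"
    using tangent_coeff_tangent_vector[OF w(1,2)] nz'
      functional_zero[OF vectorspace_T linear_functional_T[OF w(2,1)]] by auto
  moreover have "tangent_vector a1 a2 a3 \<phi> \<in> tangent_signature_part I \<sigma>"
    unfolding tangent_signature_part_def
    using tangent_vector_in_degree_part sig
    by (intro T.span_mem) (auto simp: tangent_degree_part_def)
  ultimately show ?thesis by auto
qed

end

text \<open>A source \<open>w\<close> of nonzero weight together with its target determines the
  degree. So a suitable functional \<open>tangent_coeff w m\<close> sees a single degree, and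
  independence inside each degree is enough.\<close>

lemma sum_hom_family_le_dim:
  fixes s :: "int \<times> int \<times> int \<Rightarrow> nat \<Rightarrow> int \<Rightarrow> int \<Rightarrow> int \<Rightarrow> 'k"
  assumes fam: "hom_family staircase_pred P S g s"
  shows "sum g S \<le> vectorspace.dim base_field (tangent_space I)"
proof -
  define J where "J = Sigma S (\<lambda>a. {..<g a})"
  define v where "v = (\<lambda>((a1, a2, a3), j). tangent_vector a1 a2 a3 (s (a1, a2, a3) j))"
  define L where "L = {tangent_coeff w m | w m. monom3 w \<in> I \<and> m \<in> standard_monomials}"
  have finS: "finite S" using fam by (simp add: hom_family_def)
  have ind: "indep_homs staircase_pred a1 a2 a3 (g (a1, a2, a3)) (s (a1, a2, a3))"
    if "(a1, a2, a3) \<in> S" for a1 a2 a3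
    using fam that unfolding hom_family_def by fast
  have hom: "hom_coeffs staircase_pred a1 a2 a3 (s (a1, a2, a3) j)"
    if "(a1, a2, a3) \<in> S" "j < g (a1, a2, a3)" for a1 a2 a3 j
    using ind[OF that(1)] that(2) by (simp add: indep_homs_def)
  have "card J \<le> vectorspace.dim base_field (tangent_space I)"
  proof (rule card_le_dim_of_functionals[OF vectorspace_T fin_dim_tangent_space])
    show "finite J" using finS by (simp add: J_def)
    show "v j \<in> carrier (tangent_space I)" if "j \<in> J" for j
      using that hom tangent_vector_in_carrier by (auto simp: J_def v_def)
    show "linear_functional (tangent_space I) f" if "f \<in> L" for f
      using that linear_functional_T by (auto simp: L_def)
  next
    fix c p assume c: "\<And>f. f \<in> L \<Longrightarrow> (\<Sum>p\<in>J. c p * f (v p)) = 0" and p: "p \<in> J"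
    obtain a1 a2 a3 j where aj: "p = ((a1, a2, a3), j)" by (cases p) auto
    define a where "a = (a1, a2, a3)"
    have aS: "a \<in> S" and j: "j < g a" using p by (auto simp: J_def aj a_def)
    have zero: "(\<Sum>j<g a. c (a, j) * s a j x y z) = 0" for x y z
    proof (cases "\<exists>j<g a. s a j x y z \<noteq> 0")
      case True
      then obtain i where i: "i < g a" "s a i x y z \<noteq> 0" by blast
      have homi: "hom_coeffs staircase_pred a1 a2 a3 (s a i)"
        using hom[of a1 a2 a3 i] aS i by (simp add: a_def)
      note * = hom_coeffs_nonzeroD[OF homi i(2)]
      define w where "w = vec3 (nat x) (nat y) (nat z)"
      have wxyz: "int (w $ 1) = x" "int (w $ 2) = y" "int (w $ 3) = z" using * by (auto simp: w_def)
      have nzi: "weight (s a i) w \<noteq> 0" using i by (simp add: weight_def wxyz)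
      define m where "m = target a1 a2 a3 w"
      have w: "monom3 w \<in> I" and m: "m \<in> standard_monomials"
        using weight_nonzeroD[OF homi nzi] by (auto simp: m_def)
      have val: "tangent_coeff w m (v (b, k)) = (if b = a then s a k x y z else 0)"
        if b: "b \<in> S" "k < g b" for b k
      proof -
        obtain b1 b2 b3 where b123: "b = (b1, b2, b3)" by (cases b)
        have homb: "hom_coeffs staircase_pred b1 b2 b3 (s b k)"
          using hom b by (simp add: b123)
        have 1: "tangent_coeff w m (v (b, k)) = (if m = target b1 b2 b3 w then weight (s b k) w else 0)"
          using tangent_coeff_tangent_vector[OF homb w m] by (simp add: v_def b123)
        show ?thesis
        proof (cases "b = a")
          case True
          then show ?thesis using 1 by (auto simp: b123 a_def m_def weight_def wxyz)
        next
          case False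
          \<comment> \<open>With nonzero weights no exponent of either target is truncated, so equal
            targets mean equal degrees.\<close>
          have "weight (s b k) w = 0 \<or> m \<noteq> target b1 b2 b3 w"
          proof (rule ccontr)
            assume "\<not> ?thesis"
            then have n: "weight (s b k) w \<noteq> 0" "m = target b1 b2 b3 w" by auto
            from weight_nonzeroD(3-5)[OF homb n(1)] weight_nonzeroD(3-5)[OF homi nzi] n(2)
            have "b = a" by (auto simp: m_def target_def vec3_eq_iff b123 a_def)
            with False show False by simp
          qed
          with 1 False show ?thesis by auto
        qed
      qed
      have "tangent_coeff w m \<in> L" using w m by (auto simp: L_def)
      from c[OF this] have "0 = (\<Sum>p\<in>J. c p * tangent_coeff w m (v p))" by simp
      also have "\<dots> = (\<Sum>b\<in>S. \<Sum>k<g b. c (b, k) * tangent_coeff w m (v (b, k)))"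
        unfolding J_def using finS by (subst sum.Sigma) (auto simp: case_prod_unfold)
      also have "\<dots> = (\<Sum>b\<in>S. if b = a then \<Sum>k<g a. c (a, k) * s a k x y z else 0)"
        by (intro sum.cong refl) (auto simp: val intro!: sum.neutral)
      also have "\<dots> = (\<Sum>k<g a. c (a, k) * s a k x y z)"
        using aS finS by simp
      finally show ?thesis by simp
    qed (auto intro!: sum.neutral)
    have "\<forall>j<g a. d j = 0" if "\<forall>x y z. (\<Sum>j<g a. d j * s a j x y z) = 0" for d
      using ind[of a1 a2 a3] aS that by (simp add: indep_homs_def a_def)
    from this[of "\<lambda>j. c (a, j)"] zero have "\<forall>j<g a. c (a, j) = 0" by blast
    with j show "c p = 0" by (simp add: aj a_def)
  qed
  moreover have "card J = sum g S" using finS by (simp add: J_def)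
  ultimately show ?thesis by simp
qed

end

theorem theorem4p7:
  fixes I :: "'k::field poly3 set"
  assumes "monomial_ideal I"
    and "cofinite_ideal I"
    and "\<exists>a b c. singularizing_triple I a b c"
  shows "tangent_signature_part I (sign_n, sign_n, sign_p) \<noteq> {\<zero>\<^bsub>tangent_space I\<^esub>} \<and>
    tangent_signature_part I (sign_n, sign_p, sign_n) \<noteq> {\<zero>\<^bsub>tangent_space I\<^esub>} \<and>
    tangent_signature_part I (sign_p, sign_n, sign_n) \<noteq> {\<zero>\<^bsub>tangent_space I\<^esub>} \<and>
    vectorspace.dim base_field (tangent_space I)
      \<ge> 3 * vectorspace.dim base_field (quotient_space I) + 6"
proof -
  interpret cofinite_monomial_ideal I using assms by unfold_locales
  define N where "N = staircase_pred"
  define N1 where "N1 = (\<lambda>x y z. N z x y)"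
  define N2 where "N2 = (\<lambda>x y z. N1 z x y)"
  obtain M where st: "staircase N M" using ex_staircase by (auto simp: N_def)
  have st1: "staircase N1 M" unfolding N1_def by (rule staircase_rotate[OF st])
  have st2: "staircase N2 M" unfolding N2_def by (rule staircase_rotate[OF st1])
  obtain a b c where abc: "singularizing_triple I a b c" using assms by blast
  define a1 a2 a3 b1 b2 b3 c1 c2 c3
    where "a1 = int (a $ 1)" and "a2 = int (a $ 2)" and "a3 = int (a $ 3)"
      and "b1 = int (b $ 1)" and "b2 = int (b $ 2)" and "b3 = int (b $ 3)"
      and "c1 = int (c $ 1)" and "c2 = int (c $ 2)" and "c3 = int (c $ 3)"
  note defs = a1_def a2_def a3_def b1_def b2_def b3_def c1_def c2_def c3_def
  have soc: "socle_point N a1 a2 a3" "socle_point N b1 b2 b3" "socle_point N c1 c2 c3"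
    using abc socle_point_of_socle_monomial by (auto simp: singularizing_triple_def defs N_def)
  have soc1: "socle_point N1 a2 a3 a1" "socle_point N1 b2 b3 b1" "socle_point N1 c2 c3 c1"
    using soc[THEN socle_point_rotate] by (simp_all add: N1_def)
  have soc2: "socle_point N2 a3 a1 a2" "socle_point N2 b3 b1 b2" "socle_point N2 c3 c1 c2"
    using soc1[THEN socle_point_rotate] by (simp_all add: N2_def)
  have triple: "b1 < a1" "c1 < a1" "a2 < b2" "c2 < b2" "a3 < c3" "b3 < c3"
    using abc by (auto simp: singularizing_triple_def defs)
  obtain i j t x y z and \<phi> :: "int \<Rightarrow> int \<Rightarrow> int \<Rightarrow> 'k" where
    p: "1 \<le> i" "1 \<le> j" "0 \<le> t" "hom_coeffs N (-i) (-j) t \<phi>" "\<phi> x y z \<noteq> 0"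
    using staircase.ex_nonzero_nnp_hom[OF st soc triple, where 'k = 'k] by blast
  \<comment> \<open>Signature nnp for \<open>N1\<close> is pnn in the original coordinates, and for
    \<open>N2\<close> it is npn.\<close>
  obtain i1 j1 t1 x1 y1 z1 and \<phi>1 :: "int \<Rightarrow> int \<Rightarrow> int \<Rightarrow> 'k" where
    p1: "1 \<le> i1" "1 \<le> j1" "0 \<le> t1" "hom_coeffs N1 (-i1) (-j1) t1 \<phi>1" "\<phi>1 x1 y1 z1 \<noteq> 0"
    using staircase.ex_nonzero_nnp_hom[OF st1 soc1(2,3,1) triple(4,3,6,5,1,2), where 'k = 'k] by blast
  obtain i2 j2 t2 x2 y2 z2 and \<phi>2 :: "int \<Rightarrow> int \<Rightarrow> int \<Rightarrow> 'k" where
    p2: "1 \<le> i2" "1 \<le> j2" "0 \<le> t2" "hom_coeffs N2 (-i2) (-j2) t2 \<phi>2" "\<phi>2 x2 y2 z2 \<noteq> 0"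
    using staircase.ex_nonzero_nnp_hom[OF st2 soc2(3,1,2) triple(5,6,2,1,4,3), where 'k = 'k] by blast
  have r1: "hom_coeffs N t1 (-i1) (-j1) (\<lambda>x y z. \<phi>1 y z x)"
    using p1(4) unfolding N1_def by (rule hom_coeffs_rotate)
  have "hom_coeffs N1 t2 (-i2) (-j2) (\<lambda>x y z. \<phi>2 y z x)"
    using p2(4) unfolding N2_def by (rule hom_coeffs_rotate)
  then have r2: "hom_coeffs N (-j2) t2 (-i2) (\<lambda>x y z. \<phi>2 z x y)"
    unfolding N1_def by (rule hom_coeffs_rotate)
  obtain S g and s :: "int \<times> int \<times> int \<Rightarrow> nat \<Rightarrow> int \<Rightarrow> int \<Rightarrow> int \<Rightarrow> 'k"
    where fam: "hom_family N (\<lambda>_ _ _. True) S g s" "3 * card {(x, y, z). N x y z} + 6 \<le> sum g S"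
    by (rule ex_hom_family[OF st soc triple])
  show ?thesis
  proof (intro conjI)
    show "tangent_signature_part I (sign_n, sign_n, sign_p) \<noteq> {\<zero>\<^bsub>tangent_space I\<^esub>}"
      using p by (intro tangent_signature_part_nonzero[of "-i" "-j" t \<phi> x y z]) (auto simp: N_def)
    show "tangent_signature_part I (sign_n, sign_p, sign_n) \<noteq> {\<zero>\<^bsub>tangent_space I\<^esub>}"
      using r2 p2
      by (intro tangent_signature_part_nonzero[of "-j2" t2 "-i2" "\<lambda>x y z. \<phi>2 z x y" y2 z2 x2])
        (auto simp: N_def)
    show "tangent_signature_part I (sign_p, sign_n, sign_n) \<noteq> {\<zero>\<^bsub>tangent_space I\<^esub>}"
      using r1 p1
      by (intro tangent_signature_part_nonzero[of t1 "-i1" "-j1" "\<lambda>x y z. \<phi>1 y z x" z1 x1 y1])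
        (auto simp: N_def)
    have "3 * vectorspace.dim base_field (quotient_space I) + 6 \<le> 3 * card standard_monomials + 6"
      using dim_quotient_space_le by simp
    also have "\<dots> \<le> sum g S" using fam(2) card_staircase_pred by (simp add: N_def)
    also have "\<dots> \<le> vectorspace.dim base_field (tangent_space I)"
      using fam(1) unfolding N_def by (rule sum_hom_family_le_dim)
    finally show "vectorspace.dim base_field (tangent_space I)
      \<ge> 3 * vectorspace.dim base_field (quotient_space I) + 6" .
  qed
qed

end
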